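(* Let $X=\mathbb{R}^K$, $I=\{1,\dots,N\}$, and for every $i\in I$ let $\Phi_i\in\mathcal{C}^1(X,\mathbb{R})$ with $\nabla\Phi_i$ Lipschitz with constant $L>0$. Let $\bar\Phi=\frac1N\sum_{i=1}^N\Phi_i$, $\alpha>0$ and $p_0,q_0\in X$. For $\nu>0$ let $(q^\nu_t,p^\nu_t)_{t\ge0}$ solve $$\mathrm{d}q^\nu_t=p^\nu_t\,\mathrm{d}t,\qquad \mathrm{d}p^\nu_t=-\nabla\Phi_{i(t/\nu)}(q^\nu_t)\,\mathrm{d}t-\alpha p^\nu_t\,\mathrm{d}t,\qquad p^\nu_0=p_0,\ q^\nu_0=q_0,$$ and let $(q_t,p_t)_{t\ge0}$ solve $$\mathrm{d}q_t=p_t\,\mathrm{d}t,\qquad\mathrm{d}p_t=-\nabla\bar\Phi(q_t)\,\mathrm{d}t-\alpha p_t\,\mathrm{d}t$$ with the same initial values $p_0,q_0$. Then $(q^\nu_t,p^\nu_t)_{t\ge0}$ converges weakly to $(q_t,p_t)_{t\ge0}$ in $\mathcal{C}([0,\infty),X^2)$ as $\nu\to0$, i.e. for any bounded continuous function $F:\mathcal{C}([0,\infty),X^2)\to\mathbb{R}$, $$\mathbb{E}\big[F\big((p^\nu_t,q^\nu_t)_{t\ge0}\big)\big]\to\mathbb{E}\big[F\big((p_t,q_t)_{t\ge0}\big)\big]=F\big((p_t,q_t)_{t\ge0}\big).$$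
   Context: $\mathcal{C}([0,\infty),X^2)$ is the space of continuous functions from $[0,\infty)$ to $X^2$, equipped with the metric $\rho\big((\zeta_t)_{t\ge0},(\xi_t)_{t\ge0}\big)=\int_0^\infty e^{-t}\big(1\wedge\sup_{0\le s\le t}\|\zeta_s-\xi_s\|\big)\,\mathrm{d}t$, where $a\wedge b=\min\{a,b\}$ and $\|\cdot\|$ is the Euclidean norm. The index process $(i(t))_{t\ge0}$ is the continuous-time Markov process on $I$ with transition rate matrix $\mathbf{\Gamma}_N-N\gamma\,\mathbf{I}_N$, where $\gamma>0$, $\mathbf{\Gamma}_N$ is the $N\times N$ matrix with all entries equal to $\gamma$, $\mathbf{I}_N$ is the identity matrix, and $i(0)$ is uniformly distributed on $I$. *)

theory Defs
  imports "HOL-Probability.Probability"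
begin

section \<open>Gradients\<close>

definition grad :: "('a::real_inner \<Rightarrow> real) \<Rightarrow> 'a \<Rightarrow> 'a" where
  "grad f x = (THE D. GDERIV f x :> D)"

definition C1_function :: "('a::real_inner \<Rightarrow> real) \<Rightarrow> bool" where
  "C1_function f \<longleftrightarrow> (\<forall>x. f differentiable (at x)) \<and> continuous_on UNIV (grad f)"


section \<open>Continuous paths on the half-line\<close>

text \<open>Paths are extensional, i.e. they carry no information outside \<open>{0..}\<close>, so that
  \<open>dist\<close> below separates points.\<close>

typedef (overloaded) 'a cpath =
  "{f :: real \<Rightarrow> 'a::real_normed_vector. f \<in> extensional {0..} \<and> continuous_on {0..} f}"
  morphisms cpath_at Abs_cpath
proof -
  have "continuous_on {0..} (restrict (\<lambda>t::real. 0::'a) {0..})"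
    by (subst continuous_on_cong[OF refl, of _ _ "\<lambda>_. 0"]) auto
  then show ?thesis by (intro exI[of _ "restrict (\<lambda>t. 0) {0..}"]) auto
qed

text \<open>Only meaningful if \<open>f\<close> is continuous on \<open>{0..}\<close>.\<close>

definition to_cpath :: "(real \<Rightarrow> 'a::real_normed_vector) \<Rightarrow> 'a cpath" where
  "to_cpath f = Abs_cpath (restrict f {0..})"

lemma cpath_at_to_cpath:
  assumes "continuous_on {0..} f" "0 \<le> t"
  shows "cpath_at (to_cpath f) t = f t"
proof -
  have "continuous_on {0..} (restrict f {0..})"
    using assms(1) by (subst continuous_on_cong[OF refl, of _ _ f]) auto
  then show ?thesis
    using assms(2) by (simp add: to_cpath_def Abs_cpath_inverse)
qed

lemma continuous_on_cpath_at: "continuous_on {0..} (cpath_at z)"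
  using cpath_at[of z] by simp

lemma cpath_eqI:
  assumes "\<And>t. 0 \<le> t \<Longrightarrow> cpath_at z t = cpath_at w t"
  shows "z = w"
proof -
  have "cpath_at z = cpath_at w"
    using cpath_at[of z] cpath_at[of w] assms
    by (intro extensionalityI[of _ "{0..}"]) auto
  then show ?thesis by (simp add: cpath_at_inject)
qed

definition cpath_sup :: "'a::real_normed_vector cpath \<Rightarrow> 'a cpath \<Rightarrow> real \<Rightarrow> real" where
  "cpath_sup z w t = (SUP s\<in>{0..t}. norm (cpath_at z s - cpath_at w s))"

lemma cpath_sup_bdd: "bdd_above ((\<lambda>s. norm (cpath_at z s - cpath_at w s)) ` {0..t})"
proof -
  have "continuous_on {0..t} (\<lambda>s. norm (cpath_at z s - cpath_at w s))"
    by (intro continuous_intros continuous_on_subset[OF continuous_on_cpath_at]) auto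
  then have "compact ((\<lambda>s. norm (cpath_at z s - cpath_at w s)) ` {0..t})"
    by (intro compact_continuous_image) auto
  then show ?thesis by (intro bounded_imp_bdd_above compact_imp_bounded)
qed

lemma cpath_sup_ge:
  "0 \<le> s \<Longrightarrow> s \<le> t \<Longrightarrow> norm (cpath_at z s - cpath_at w s) \<le> cpath_sup z w t"
  unfolding cpath_sup_def by (intro cSUP_upper cpath_sup_bdd) auto

lemma cpath_sup_nonneg: "0 \<le> t \<Longrightarrow> 0 \<le> cpath_sup z w t"
  using cpath_sup_ge[of 0 t z w] norm_ge_zero order_trans by blast

lemma cpath_sup_mono: "0 \<le> s \<Longrightarrow> s \<le> t \<Longrightarrow> cpath_sup z w s \<le> cpath_sup z w t"
  unfolding cpath_sup_def by (rule cSUP_subset_mono) (auto intro: cpath_sup_bdd)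

lemma cpath_sup_triangle:
  assumes "0 \<le> t"
  shows "cpath_sup z w t \<le> cpath_sup z v t + cpath_sup v w t"
proof -
  have "norm (cpath_at z s - cpath_at w s) \<le> cpath_sup z v t + cpath_sup v w t"
    if "s \<in> {0..t}" for s
  proof -
    have "norm (cpath_at z s - cpath_at w s)
        \<le> norm (cpath_at z s - cpath_at v s) + norm (cpath_at v s - cpath_at w s)"
      using dist_triangle[of "cpath_at z s" "cpath_at w s" "cpath_at v s"]
      by (simp add: dist_norm)
    also have "\<dots> \<le> cpath_sup z v t + cpath_sup v w t"
      using that by (intro add_mono cpath_sup_ge) auto
    finally show ?thesis .
  qed
  then show ?thesis
    using assms unfolding cpath_sup_def[of z w] by (intro cSUP_least) auto
qed

lemma cpath_dist_integrable:
  "set_integrable lborel {0..} (\<lambda>t. exp (- t) * min 1 (cpath_sup z w t))"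
proof (rule set_integrable_bound)
  have "(\<lambda>x. exp (- 1 * x)) absolutely_integrable_on {0::real..}"
    by (intro nonnegative_absolutely_integrable_1 integrable_on_exp_minus_to_infinity) auto
  then show "set_integrable lborel {0::real..} (\<lambda>x. exp (- x))"
    by (simp add: set_integrable_def integrable_completion)
  have mono: "mono (\<lambda>t. cpath_sup z w (max 0 t))"
    by (intro monoI cpath_sup_mono) auto
  have [measurable]: "(\<lambda>t. cpath_sup z w (max 0 t)) \<in> borel_measurable borel"
    by (rule borel_measurable_mono[OF mono])
  have "(\<lambda>t. indicator {0..} t *\<^sub>R (exp (- t) * min 1 (cpath_sup z w (max 0 t))))
      \<in> borel_measurable lborel"
    by measurable
  also have "(\<lambda>t. indicator {0..} t *\<^sub>R (exp (- t) * min 1 (cpath_sup z w (max 0 t))))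
      = (\<lambda>t. indicator {0..} t *\<^sub>R (exp (- t) * min 1 (cpath_sup z w t)))"
    by (auto simp: indicator_def)
  finally show "set_borel_measurable lborel {0..} (\<lambda>t. exp (- t) * min 1 (cpath_sup z w t))"
    by (simp add: set_borel_measurable_def)
  show "AE x in lborel. x \<in> {0..} \<longrightarrow>
      norm (exp (- x) * min 1 (cpath_sup z w x)) \<le> norm (exp (- x))"
    by (auto simp: abs_mult min_def cpath_sup_nonneg)
qed

instantiation cpath :: (real_normed_vector) metric_space
begin

definition dist_cpath :: "'a cpath \<Rightarrow> 'a cpath \<Rightarrow> real" where
  "dist_cpath z w =
    (LBINT t:{0..}. exp (- t) * min 1 (SUP s\<in>{0..t}. norm (cpath_at z s - cpath_at w s)))"

definition uniformity_cpath :: "('a cpath \<times> 'a cpath) filter" where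
  "uniformity_cpath = (INF e\<in>{0<..}. principal {(x, y). dist x y < e})"

definition open_cpath :: "'a cpath set \<Rightarrow> bool" where
  "open_cpath U \<longleftrightarrow> (\<forall>x\<in>U. eventually (\<lambda>(x', y). x' = x \<longrightarrow> y \<in> U) uniformity)"

instance
proof
  have D: "dist z w = (LBINT t:{0..}. exp (- t) * min 1 (cpath_sup z w t))" for z w :: "'a cpath"
    by (simp add: dist_cpath_def cpath_sup_def)
  show "uniformity = (INF e\<in>{0<..}. principal {(x :: 'a cpath, y). dist x y < e})"
    by (rule uniformity_cpath_def)
  show "open U \<longleftrightarrow> (\<forall>x\<in>U. eventually (\<lambda>(x', y). x' = x \<longrightarrow> y \<in> U) uniformity)"
    for U :: "'a cpath set"
    by (rule open_cpath_def)
  show "dist z w = 0 \<longleftrightarrow> z = w" for z w :: "'a cpath"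
  proof
    assume "z = w"
    then have "cpath_sup z w t = 0" if "0 \<le> t" for t
      using that by (simp add: cpath_sup_def)
    then have "(\<lambda>t. indicator {0..} t *\<^sub>R (exp (- t) * min 1 (cpath_sup z w t))) = (\<lambda>t. 0)"
      by (auto simp: indicator_def fun_eq_iff)
    then show "dist z w = 0" unfolding D set_lebesgue_integral_def by simp
  next
    assume 0: "dist z w = 0"
    show "z = w"
    proof (rule cpath_eqI, rule ccontr)
      fix a :: real
      assume a: "0 \<le> a" "cpath_at z a \<noteq> cpath_at w a"
      define c where "c = exp (- (a + 1)) * min 1 (norm (cpath_at z a - cpath_at w a))"
      have c: "0 < c" using a by (simp add: c_def)
      have le: "indicator {a..a+1} t * c \<le> exp (- t) * min 1 (cpath_sup z w t)"
        if "t \<in> {0..}" for t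
      proof (cases "t \<in> {a..a+1}")
        case True
        then show ?thesis
          using cpath_sup_ge[of a t z w] a unfolding c_def
          by (simp, intro mult_mono) auto
      next
        case False
        then show ?thesis using that by (simp add: cpath_sup_nonneg)
      qed
      have eq: "(\<lambda>t. indicator {0..} t *\<^sub>R (indicator {a..a+1} t * c)) = (\<lambda>t. indicator {a..a+1} t *\<^sub>R c)"
        using a by (auto simp: indicator_def fun_eq_iff)
      have int: "set_integrable lborel {0..} (\<lambda>t. indicator {a..a+1} t * c)"
        unfolding set_integrable_def eq by simp
      have "c = (LBINT t:{0..}. indicator {a..a+1} t * c)"
        unfolding set_lebesgue_integral_def eq by simp
      also have "\<dots> \<le> dist z w"
        unfolding D by (rule set_integral_mono[OF int cpath_dist_integrable le])
      finally show False using 0 c by simp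
    qed
  qed
  show "dist z w \<le> dist z v + dist w v" for z w v :: "'a cpath"
  proof -
    have sym: "cpath_sup w v = cpath_sup v w"
      by (simp add: cpath_sup_def norm_minus_commute fun_eq_iff)
    have "dist z w \<le> (LBINT t:{0..}. exp (- t) * min 1 (cpath_sup z v t)
        + exp (- t) * min 1 (cpath_sup w v t))"
      unfolding D
    proof (rule set_integral_mono)
      fix t :: real assume t: "t \<in> {0..}"
      have "min 1 (cpath_sup z w t) \<le> min 1 (cpath_sup z v t) + min 1 (cpath_sup w v t)"
        using cpath_sup_triangle[of t z w v] t cpath_sup_nonneg[of t z v] cpath_sup_nonneg[of t v w]
        by (auto simp: min_def sym)
      then show "exp (- t) * min 1 (cpath_sup z w t)
          \<le> exp (- t) * min 1 (cpath_sup z v t) + exp (- t) * min 1 (cpath_sup w v t)"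
        by (simp flip: distrib_left)
    qed (auto intro!: set_integral_add cpath_dist_integrable)
    also have "\<dots> = dist z v + dist w v"
      unfolding D by (intro set_integral_add cpath_dist_integrable)
    finally show ?thesis .
  qed
qed

end


section \<open>Continuous-time Markov chains on a finite state space\<close>

definition matrix_exp :: "real^'n^'n \<Rightarrow> real^'n^'n" where
  "matrix_exp A = (\<Sum>k. (1 / fact k) *\<^sub>R (((**) A ^^ k) (mat 1)))"

definition natural_filtration :: "'w measure \<Rightarrow> (real \<Rightarrow> 'w \<Rightarrow> 'n) \<Rightarrow> real \<Rightarrow> 'w measure" where
  "natural_filtration M X s =
    sigma (space M) {X u -` {z} \<inter> space M | u z. 0 \<le> u \<and> u \<le> s}"

text \<open>Right-continuity and existence of left limits are with respect to the discrete topology of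
  the state space. The transition function generated by the rate matrix \<open>Q\<close> is
  \<open>matrix_exp (t *\<^sub>R Q)\<close>.\<close>

definition markov_chain_with_rates ::
  "'w measure \<Rightarrow> real^'n^'n \<Rightarrow> (real \<Rightarrow> 'w \<Rightarrow> 'n::finite) \<Rightarrow> bool" where
  "markov_chain_with_rates M Q X \<longleftrightarrow>
     (\<forall>t\<ge>0. X t \<in> measurable M (count_space UNIV)) \<and>
     (\<forall>\<omega>\<in>space M. \<forall>t\<ge>0. \<forall>\<^sub>F s in at_right t. X s \<omega> = X t \<omega>) \<and>
     (\<forall>\<omega>\<in>space M. \<forall>t>0. \<exists>y. \<forall>\<^sub>F s in at_left t. X s \<omega> = y) \<and>
     (\<forall>s\<ge>0. \<forall>t\<ge>0. \<forall>y. AE \<omega> in M.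
        real_cond_exp M (natural_filtration M X s) (indicator {\<omega>'\<in>space M. X (s + t) \<omega>' = y}) \<omega>
          = matrix_exp (t *\<^sub>R Q) $ X s \<omega> $ y)"

text \<open>The index process: rate matrix \<open>\<Gamma> - N\<gamma> I\<close> with all entries of \<open>\<Gamma>\<close> equal to \<open>\<gamma>\<close>.\<close>

definition index_process :: "'w measure \<Rightarrow> real \<Rightarrow> (real \<Rightarrow> 'w \<Rightarrow> 'n::finite) \<Rightarrow> bool" where
  "index_process M \<gamma> X \<longleftrightarrow>
     markov_chain_with_rates M ((\<chi> i j. \<gamma>) - (real CARD('n) * \<gamma>) *\<^sub>R mat 1) X \<and>
     distr M (count_space UNIV) (X 0) = uniform_count_measure UNIV"


section \<open>Momentum dynamics\<close>

text \<open>\<open>dq = p dt\<close>, \<open>dp = - g t q dt - \<alpha> p dt\<close> in integral form: for a force field \<open>g\<close> that jumps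
  in time, \<open>p\<close> is not differentiable at the jump times.\<close>

definition momentum_solution ::
  "(real \<Rightarrow> 'a \<Rightarrow> 'a) \<Rightarrow> real \<Rightarrow> 'a \<Rightarrow> 'a \<Rightarrow> (real \<Rightarrow> 'a::euclidean_space) \<Rightarrow> (real \<Rightarrow> 'a) \<Rightarrow> bool" where
  "momentum_solution g \<alpha> q0 p0 q p \<longleftrightarrow>
     continuous_on {0..} q \<and> continuous_on {0..} p \<and> q 0 = q0 \<and> p 0 = p0 \<and>
     (\<forall>t\<ge>0. (p has_integral (q t - q0)) {0..t} \<and>
            ((\<lambda>s. - g s (q s) - \<alpha> *\<^sub>R p s) has_integral (p t - p0)) {0..t})"

end

theory Submission
  imports Defs
begin

text \<open>
  The position \<open>q\<close> and the momentum \<open>p\<close> see the random index only through its time integral, and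
  over any fixed time window the fast process \<open>i (t / \<nu>)\<close> visits all indices equally often. This is
  the averaging principle, and the proof makes it quantitative in terms of the occupation times
  \<open>A j t = \<integral>\<^sub>0\<^sup>t of_bool (i (s / \<nu>) = j) ds\<close>.

  The deterministic half treats the random force and the averaged force alike, as mixtures
  \<open>\<Sum>j. w s j *\<^sub>R g j x\<close> with time-dependent weights: the weights are the indicators of the current
  index in one case and the constants \<open>1 / N\<close> in the other. Let two such systems with weights \<open>w\<close>
  and \<open>w'\<close> start from the same point. Inserting the solution \<open>q\<close> of the first one into the force
  of the second leaves the defect \<open>\<integral>\<^sub>0\<^sup>t \<Sum>j. (w' s j - w s j) *\<^sub>R g j (q s) ds\<close>. The integrands
  \<open>g j (q s)\<close> are fixed continuous functions, and the differences of the weights are bounded by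
  \<open>1\<close>, so the defect is small on \<open>[0, T]\<close> as soon as the occupation times of \<open>w\<close> and \<open>w'\<close> are
  close on a fine grid of times (\<open>small_primitive_imp_small_weighted_integral\<close>). A Gronwall
  estimate turns a small defect into a small distance of the solutions
  (\<open>momentum_solution_stable\<close>). Hence the solution, as an element of the path space, depends
  continuously on the occupation times at finitely many rational times
  (\<open>solution_continuous_in_occupation\<close>).

  This continuity is used twice. Around the averaged solution it bounds the distance of the random
  solution from its limit. Around an arbitrary random solution it shows that the random path is
  measurable: the path is a continuous function of countably many real random variables
  (\<open>measurable_solution_path\<close>). Without measurability the expectations in the theorem would be
  the default value of the integral.

  The probabilistic half is a weak law of large numbers for the occupation times. The rate matrix is
  a multiple of a projection, so its exponential is explicit, and the covariance of the events
  \<open>i s = j\<close> and \<open>i t = j\<close> is at most \<open>exp (- N \<gamma> \<bar>t - s\<bar>)\<close>. Under the time change this decay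
  becomes \<open>exp (- N \<gamma> \<bar>t - s\<bar> / \<nu>)\<close>, and summing the covariances gives a variance of order \<open>\<nu>\<close>
  (\<open>occupation_time_ergodic\<close>). Chebyshev's inequality, the continuity of \<open>F\<close> at the averaged
  solution, and the boundedness of \<open>F\<close> on the exceptional event conclude the proof.
\<close>

section \<open>Stability of the momentum dynamics under perturbed forces\<close>

text \<open>
  At a point where \<open>u t * exp (- 2 * K * t)\<close> attains its maximum \<open>m\<close>, the hypothesis yields
  \<open>m \<le> \<epsilon> + m / 2\<close> if \<open>m \<ge> 0\<close>, because the weight \<open>exp (2 * K * t)\<close> makes the integral term count only
  half. The doubled rate costs a worse constant than the classical bound but avoids differentiating
  the integral.
\<close>

lemma gronwall_integral:
  fixes u :: "real \<Rightarrow> real"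
  assumes cont: "continuous_on {0..T} u" and "0 < K" "0 \<le> \<epsilon>"
    and le: "\<And>t. t \<in> {0..T} \<Longrightarrow> u t \<le> \<epsilon> + K * integral {0..t} u"
    and t: "t \<in> {0..T}"
  shows "u t \<le> 2 * \<epsilon> * exp (2 * K * t)"
proof -
  have "continuous_on {0..T} (\<lambda>t. u t * exp (- (2 * K * t)))"
    by (intro continuous_intros cont)
  then obtain \<tau> where \<tau>: "\<tau> \<in> {0..T}"
    and max: "\<And>s. s \<in> {0..T} \<Longrightarrow> u s * exp (- (2 * K * s)) \<le> u \<tau> * exp (- (2 * K * \<tau>))"
    using continuous_attains_sup[of "{0..T}" "\<lambda>t. u t * exp (- (2 * K * t))"] t by auto
  define m where "m = u \<tau> * exp (- (2 * K * \<tau>))"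
  have u_le: "u s \<le> m * exp (2 * K * s)" if "s \<in> {0..T}" for s
    using mult_right_mono[OF max[OF that], of "exp (2 * K * s)"]
    by (simp add: m_def mult.assoc flip: exp_add)
  have u_\<tau>: "u \<tau> = m * exp (2 * K * \<tau>)"
    by (simp add: m_def mult.assoc flip: exp_add)
  have "((\<lambda>s. m * exp (2 * K * s)) has_integral
      (m / (2 * K) * exp (2 * K * \<tau>) - m / (2 * K) * exp (2 * K * 0))) {0..\<tau>}"
    using \<tau> \<open>0 < K\<close>
    by (intro fundamental_theorem_of_calculus)
      (auto intro!: derivative_eq_intros simp flip: has_real_derivative_iff_has_vector_derivative)
  then have I: "((\<lambda>s. m * exp (2 * K * s)) has_integral (m * (exp (2 * K * \<tau>) - 1) / (2 * K))) {0..\<tau>}"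
    by (simp add: right_diff_distrib diff_divide_distrib)
  have "u integrable_on {0..\<tau>}"
    using \<tau> by (intro integrable_continuous_real continuous_on_subset[OF cont]) auto
  then have "integral {0..\<tau>} u \<le> m * (exp (2 * K * \<tau>) - 1) / (2 * K)"
    using \<tau> by (intro has_integral_le[OF integrable_integral I] u_le) auto
  then have "K * integral {0..\<tau>} u \<le> K * (m * (exp (2 * K * \<tau>) - 1) / (2 * K))"
    using \<open>0 < K\<close> by (intro mult_left_mono) auto
  then have "m * exp (2 * K * \<tau>) \<le> \<epsilon> + m * (exp (2 * K * \<tau>) - 1) / 2"
    using le[OF \<tau>] u_\<tau> \<open>0 < K\<close> by simp
  then have *: "m * exp (2 * K * \<tau>) + m \<le> 2 * \<epsilon>"
    by (simp add: right_diff_distrib field_simps)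
  have "m \<le> 2 * \<epsilon>"
  proof (cases "m \<le> 0")
    case False
    then have "0 \<le> m * exp (2 * K * \<tau>)" by simp
    with * show ?thesis by linarith
  qed (use \<open>0 \<le> \<epsilon>\<close> in linarith)
  then have "m * exp (2 * K * t) \<le> 2 * \<epsilon> * exp (2 * K * t)"
    by (intro mult_right_mono) auto
  with u_le[OF t] show ?thesis by linarith
qed

text \<open>
  Here \<open>e\<close> is the accumulated defect of the solution \<open>(q, p)\<close> in the system driven by \<open>f'\<close>. Only
  its primitive has to be small, not the integrand: a force that jumps quickly between several
  values may be far from its average at every single time.
\<close>

lemma momentum_solution_stable:
  fixes f f' :: "real \<Rightarrow> 'a::euclidean_space \<Rightarrow> 'a"
  assumes sol: "momentum_solution f \<alpha> q0 p0 q p"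
    and sol': "momentum_solution f' \<alpha> q0 p0 q' p'"
    and lip: "\<And>s x y. 0 \<le> s \<Longrightarrow> norm (f' s x - f' s y) \<le> L * norm (x - y)"
    and "0 \<le> L" "0 \<le> \<alpha>"
    and err: "\<And>t. t \<in> {0..T} \<Longrightarrow> ((\<lambda>s. f' s (q s) - f s (q s)) has_integral e t) {0..t}"
    and e: "\<And>t. t \<in> {0..T} \<Longrightarrow> norm (e t) \<le> \<epsilon>"
    and t: "t \<in> {0..T}"
  shows "norm (q' t - q t) + norm (p' t - p t) \<le> 2 * \<epsilon> * exp (2 * (1 + L + \<alpha>) * t)"
proof -
  define u where "u = (\<lambda>t. norm (q' t - q t) + norm (p' t - p t))"
  have cont: "continuous_on {0..} q" "continuous_on {0..} p"
      "continuous_on {0..} q'" "continuous_on {0..} p'"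
    using sol sol' by (auto simp: momentum_solution_def)
  have q_int: "((\<lambda>s. p' s - p s) has_integral (q' t - q t)) {0..t}" if "0 \<le> t" for t
  proof -
    have "(p has_integral (q t - q0)) {0..t}" "(p' has_integral (q' t - q0)) {0..t}"
      using sol sol' that by (auto simp: momentum_solution_def)
    from has_integral_diff[OF this(2,1)] show ?thesis by simp
  qed
  have p_int: "((\<lambda>s. - (f' s (q' s) - f' s (q s)) - \<alpha> *\<^sub>R (p' s - p s))
      has_integral (p' t - p t + e t)) {0..t}" if "t \<in> {0..T}" for t
  proof -
    have "((\<lambda>s. - f s (q s) - \<alpha> *\<^sub>R p s) has_integral (p t - p0)) {0..t}"
      "((\<lambda>s. - f' s (q' s) - \<alpha> *\<^sub>R p' s) has_integral (p' t - p0)) {0..t}"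
      using sol sol' that by (auto simp: momentum_solution_def)
    from has_integral_add[OF has_integral_diff[OF this(2,1)] err[OF that]]
    show ?thesis by (simp add: algebra_simps)
  qed
  have u_cont: "continuous_on {0..T} u"
    unfolding u_def by (intro continuous_intros continuous_on_subset[OF cont(1)]
      continuous_on_subset[OF cont(2)] continuous_on_subset[OF cont(3)]
      continuous_on_subset[OF cont(4)]) auto
  have "u t \<le> \<epsilon> + (1 + L + \<alpha>) * integral {0..t} u" if t: "t \<in> {0..T}" for t
  proof -
    have ui: "u integrable_on {0..t}"
      using t by (intro integrable_continuous_real continuous_on_subset[OF u_cont]) auto
    have "norm (integral {0..t} (\<lambda>s. p' s - p s)) \<le> integral {0..t} u"
      using q_int[of t] t by (intro integral_norm_bound_integral ui) (auto simp: u_def)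
    then have Q: "norm (q' t - q t) \<le> integral {0..t} u"
      using q_int[of t] t by (auto simp: integral_unique)
    have "norm (integral {0..t} (\<lambda>s. - (f' s (q' s) - f' s (q s)) - \<alpha> *\<^sub>R (p' s - p s)))
        \<le> integral {0..t} (\<lambda>s. (L + \<alpha>) * u s)"
    proof (rule integral_norm_bound_integral)
      show "(\<lambda>s. - (f' s (q' s) - f' s (q s)) - \<alpha> *\<^sub>R (p' s - p s)) integrable_on {0..t}"
        using p_int[OF t] by (rule has_integral_integrable)
      show "(\<lambda>s. (L + \<alpha>) * u s) integrable_on {0..t}"
        using integrable_cmul[OF ui, of "L + \<alpha>"] by simp
      fix s assume s: "s \<in> {0..t}"
      have "norm (- (f' s (q' s) - f' s (q s)) - \<alpha> *\<^sub>R (p' s - p s))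
          \<le> norm (f' s (q' s) - f' s (q s)) + \<alpha> * norm (p' s - p s)"
        using norm_triangle_ineq4[of "- (f' s (q' s) - f' s (q s))" "\<alpha> *\<^sub>R (p' s - p s)"] \<open>0 \<le> \<alpha>\<close>
        by (simp add: norm_minus_commute)
      also have "\<dots> \<le> L * norm (q' s - q s) + \<alpha> * norm (p' s - p s)"
        using lip[of s] s by simp
      also have "\<dots> \<le> (L + \<alpha>) * u s"
        using \<open>0 \<le> L\<close> \<open>0 \<le> \<alpha>\<close> by (simp add: u_def algebra_simps)
      finally show "norm (- (f' s (q' s) - f' s (q s)) - \<alpha> *\<^sub>R (p' s - p s)) \<le> (L + \<alpha>) * u s" .
    qed
    then have "norm (p' t - p t + e t) \<le> (L + \<alpha>) * integral {0..t} u"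
      using integral_unique[OF p_int[OF t]] by simp
    moreover have "norm (p' t - p t) \<le> norm (p' t - p t + e t) + norm (e t)"
      using norm_triangle_ineq4[of "p' t - p t + e t" "e t"] by simp
    ultimately show ?thesis
      using Q e[OF t] by (simp add: u_def algebra_simps)
  qed
  moreover have "0 \<le> \<epsilon>" using norm_ge_zero e[OF t] by (rule order_trans)
  ultimately have "u t \<le> 2 * \<epsilon> * exp (2 * (1 + L + \<alpha>) * t)"
    using \<open>0 \<le> L\<close> \<open>0 \<le> \<alpha>\<close> by (intro gronwall_integral[OF u_cont _ _ _ t]) auto
  then show ?thesis by (simp add: u_def)
qed

lemma integrable_on_scaleR_continuous:
  fixes G :: "real \<Rightarrow> 'a::euclidean_space"
  assumes h: "h integrable_on {0..T}" and b: "\<And>s. s \<in> {0..T} \<Longrightarrow> \<bar>h s\<bar> \<le> B"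
    and G: "continuous_on {0..T} G"
  shows "(\<lambda>s. h s *\<^sub>R G s) integrable_on {0..T}"
proof -
  have "h absolutely_integrable_on {0..T}"
    using b by (intro absolutely_integrable_integrable_bound[where g = "\<lambda>_. B"] h) auto
  moreover have "bounded (G ` {0..T})"
    by (intro compact_imp_bounded compact_continuous_image G) auto
  moreover have "G \<in> borel_measurable (lebesgue_on {0..T})"
    by (intro continuous_imp_measurable_on_sets_lebesgue G) auto
  moreover have "bilinear (\<lambda>x (c::real). c *\<^sub>R x :: 'a)"
    by (auto simp: bilinear_def intro!: linearI simp: algebra_simps)
  ultimately have "(\<lambda>s. h s *\<^sub>R G s) absolutely_integrable_on {0..T}"
    using absolutely_integrable_bounded_measurable_product[of "\<lambda>x c. c *\<^sub>R x" G "{0..T}" h] by auto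
  then show ?thesis by (rule set_lebesgue_integral_eq_integral(1))
qed

text \<open>
  On a grid so fine that \<open>G\<close> is nearly constant on each block, the weighted integral over a block is
  nearly the increment of the primitive of \<open>h\<close> times a value of \<open>G\<close>. The grid and the tolerance
  \<open>\<eta>\<close> depend on \<open>G\<close> but not on \<open>h\<close>, which makes the set of admissible \<open>h\<close> a neighbourhood defined
  by finitely many observables. The grid points are rational so that countably many of them serve
  for all \<open>G\<close> and \<open>T\<close>.
\<close>

lemma small_primitive_imp_small_weighted_integral:
  fixes G :: "real \<Rightarrow> 'a::euclidean_space" and T :: nat
  assumes G: "continuous_on {0..real T} G" and "0 < \<epsilon>"
  obtains S :: "rat set" and \<eta> :: real
  where "finite S" "S \<subseteq> {0..}" "0 < \<eta>"
    "\<And>h t. \<lbrakk>h integrable_on {0..real T}; \<And>s. s \<in> {0..real T} \<Longrightarrow> \<bar>h s\<bar> \<le> 1;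
        \<And>r. r \<in> S \<Longrightarrow> \<bar>integral {0..of_rat r} h\<bar> < \<eta>; t \<in> {0..real T}\<rbrakk>
      \<Longrightarrow> norm (integral {0..t} (\<lambda>s. h s *\<^sub>R G s)) \<le> \<epsilon>"
proof -
  have "bounded (G ` {0..real T})"
    by (intro compact_imp_bounded compact_continuous_image G) auto
  then obtain C where C: "0 < C" "\<And>s. s \<in> {0..real T} \<Longrightarrow> norm (G s) \<le> C"
    by (auto simp: bounded_pos)
  \<comment> \<open>Error budget: at most \<open>\<epsilon> / 4\<close> each for the oscillation of \<open>G\<close> within the blocks, for the
    primitive of \<open>h\<close> at the grid points, and for the last incomplete block.\<close>
  define \<epsilon>' where "\<epsilon>' = \<epsilon> / (4 * (real T + 1))"
  have "\<epsilon>' > 0" using \<open>0 < \<epsilon>\<close> by (simp add: \<epsilon>'_def)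
  have "uniformly_continuous_on {0..real T} G"
    by (intro compact_uniformly_continuous G) auto
  then obtain d where d: "d > 0"
    "\<And>s r. s \<in> {0..real T} \<Longrightarrow> r \<in> {0..real T} \<Longrightarrow> dist s r < d \<Longrightarrow> dist (G s) (G r) < \<epsilon>'"
    using \<open>\<epsilon>' > 0\<close> unfolding uniformly_continuous_on_def by metis
  obtain m :: nat where m: "real m > max (1 / d) (4 * C / \<epsilon>)"
    using reals_Archimedean2 by blast
  have "0 < m" using m \<open>d > 0\<close> by (metis less_max_iff_disj max.strict_boundedE not_gr_zero of_nat_0 order_less_asym zero_less_divide_1_iff)
  then have m0: "0 < real m" by simp
  have md: "1 / m < d" using m m0 \<open>d > 0\<close> by (simp add: field_simps)
  have mC: "C / m \<le> \<epsilon> / 4" using m m0 \<open>0 < \<epsilon>\<close> by (simp add: field_simps)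
  define \<eta> where "\<eta> = \<epsilon> / (8 * C * (real T * m + 1))"
  have D0: "0 < C * (real T * m + 1)" using C by (intro mult_pos_pos add_nonneg_pos) auto
  have "\<eta> > 0" unfolding \<eta>_def using \<open>0 < \<epsilon>\<close> D0 by (simp add: mult.assoc)
  define S :: "rat set" where "S = (\<lambda>k. of_nat k / of_nat m) ` {..T * m}"
  show thesis
  proof (rule that)
    show "finite S" by (simp add: S_def)
    show "S \<subseteq> {0..}" by (auto simp: S_def)
    show "\<eta> > 0" by fact
    fix h :: "real \<Rightarrow> real" and t
    assume h: "h integrable_on {0..real T}" and h1: "\<And>s. s \<in> {0..real T} \<Longrightarrow> \<bar>h s\<bar> \<le> 1"
      and small: "\<And>r. r \<in> S \<Longrightarrow> \<bar>integral {0..of_rat r} h\<bar> < \<eta>" and t: "t \<in> {0..real T}"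
    let ?f = "\<lambda>s. h s *\<^sub>R G s"
    have grid: "\<bar>integral {0..k / m} h\<bar> < \<eta>" if "k \<le> T * m" for k :: nat
      using small[of "of_nat k / of_nat m"] that by (auto simp: S_def of_rat_divide)
    have le_T: "k / m \<le> real T" if "k \<le> T * m" for k :: nat
    proof -
      have "real k \<le> real (T * m)" using that by (rule of_nat_mono)
      then show ?thesis using m0 by (simp add: field_simps)
    qed
    have hi: "h integrable_on {a..b}" if "0 \<le> a" "b \<le> real T" for a b
      using that by (intro integrable_on_subinterval[OF h]) auto
    have fi: "?f integrable_on {a..b}" if "0 \<le> a" "b \<le> real T" for a b
      using that by (intro integrable_on_subinterval[OF integrable_on_scaleR_continuous[OF h h1 G]]) auto
    have blocks: "norm (integral {0..k / m} ?f) \<le> k * (\<epsilon>' / m + 2 * \<eta> * C)" if "k \<le> T * m" for k :: nat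
      using that
    proof (induction k)
      case 0
      then show ?case by simp
    next
      case (Suc k)
      let ?a = "k / m" and ?b = "Suc k / m"
      have ab: "0 \<le> ?a" "?a \<le> ?b" "?b \<le> real T" "?b - ?a = 1 / m"
        using le_T[OF Suc.prems] m0 by (auto simp: field_simps)
      have "(\<lambda>s. ?f s - h s *\<^sub>R G ?a) integrable_on {?a..?b}"
        by (intro integrable_diff fi integrable_on_scaleR_left hi) (use ab in auto)
      then have di: "(\<lambda>s. h s *\<^sub>R (G s - G ?a)) integrable_on {?a..?b}"
        by (simp add: scaleR_diff_right)
      have "norm (h s *\<^sub>R (G s - G ?a)) \<le> \<epsilon>'" if "s \<in> {?a..?b}" for s
      proof -
        have "dist s ?a < d" using that ab md by (auto simp: dist_real_def)
        moreover have s: "s \<in> {0..real T}" and "?a \<in> {0..real T}"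
          using that ab unfolding atLeastAtMost_iff by linarith+
        ultimately have "norm (G s - G ?a) \<le> \<epsilon>'"
          using d(2)[of s ?a] by (simp add: dist_norm)
        moreover have "\<bar>h s\<bar> \<le> 1" using h1 s by auto
        ultimately have "\<bar>h s\<bar> * norm (G s - G ?a) \<le> 1 * \<epsilon>'" by (intro mult_mono) auto
        then show ?thesis by simp
      qed
      with di have "norm (integral {?a..?b} (\<lambda>s. h s *\<^sub>R (G s - G ?a))) \<le> integral {?a..?b} (\<lambda>_. \<epsilon>')"
        by (intro integral_norm_bound_integral) auto
      then have 1: "norm (integral {?a..?b} (\<lambda>s. h s *\<^sub>R (G s - G ?a))) \<le> \<epsilon>' / m"
        using ab by simp
      have "integral {0..?a} h + integral {?a..?b} h = integral {0..?b} h"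
        using ab by (intro Henstock_Kurzweil_Integration.integral_combine hi) auto
      then have "\<bar>integral {?a..?b} h\<bar> \<le> 2 * \<eta>"
        using grid[of k] grid[of "Suc k"] Suc.prems by linarith
      then have 2: "norm (integral {?a..?b} h *\<^sub>R G ?a) \<le> 2 * \<eta> * C"
        using C(2)[of ?a] ab \<open>\<eta> > 0\<close> unfolding norm_scaleR by (intro mult_mono) auto
      have "integral {?a..?b} ?f = integral {?a..?b} (\<lambda>s. h s *\<^sub>R (G s - G ?a) + h s *\<^sub>R G ?a)"
        by (simp add: algebra_simps)
      also have "\<dots> = integral {?a..?b} (\<lambda>s. h s *\<^sub>R (G s - G ?a)) + integral {?a..?b} (\<lambda>s. h s *\<^sub>R G ?a)"
        using ab by (intro integral_add di integrable_on_scaleR_left hi) auto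
      also have "integral {?a..?b} (\<lambda>s. h s *\<^sub>R G ?a) = integral {?a..?b} h *\<^sub>R G ?a"
        using ab by (intro integral_unique has_integral_scaleR_left integrable_integral hi) auto
      finally have 3: "integral {?a..?b} ?f = integral {?a..?b} (\<lambda>s. h s *\<^sub>R (G s - G ?a)) + integral {?a..?b} h *\<^sub>R G ?a" .
      have "integral {0..?b} ?f = integral {0..?a} ?f + integral {?a..?b} ?f"
        using ab by (intro Henstock_Kurzweil_Integration.integral_combine[symmetric] fi) auto
      then have "norm (integral {0..?b} ?f) \<le> norm (integral {0..?a} ?f) + norm (integral {?a..?b} ?f)"
        by (simp add: norm_triangle_ineq)
      also have "norm (integral {?a..?b} ?f) \<le> \<epsilon>' / m + 2 * \<eta> * C"
        unfolding 3 by (rule order_trans[OF norm_triangle_ineq add_mono[OF 1 2]])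
      finally show ?case using Suc by (simp add: algebra_simps add_divide_distrib)
    qed
    define k where "k = nat \<lfloor>t * m\<rfloor>"
    have tm: "0 \<le> t * m" using t by simp
    have k: "real k \<le> t * m" "t * m < real k + 1" unfolding k_def using tm by linarith+
    have "t * m \<le> real (T * m)" using t m0 by simp
    then have kT: "k \<le> T * m" using k(1) by (metis of_nat_le_iff order_trans)
    let ?a = "k / m"
    have "?a \<le> t" "t \<le> (real k + 1) / m"
      using k m0 by (simp_all add: pos_divide_le_eq pos_le_divide_eq)
    then have a: "0 \<le> ?a" "?a \<le> t" "t - ?a \<le> 1 / m" by (simp_all add: add_divide_distrib)
    have "norm (integral {?a..t} ?f) \<le> integral {?a..t} (\<lambda>_. C)"
    proof (rule integral_norm_bound_integral)
      fix s assume "s \<in> {?a..t}"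
      then have s: "s \<in> {0..real T}" using order_trans[OF a(1)] t by auto
      have "\<bar>h s\<bar> * norm (G s) \<le> 1 * C" using C(2)[OF s] h1[OF s] by (intro mult_mono) auto
      then show "norm (h s *\<^sub>R G s) \<le> C" by simp
    qed (use a t fi in auto)
    also have "\<dots> = (t - ?a) * C" using a by simp
    also have "\<dots> \<le> 1 / m * C" using a C by (intro mult_right_mono) auto
    also have "\<dots> \<le> \<epsilon> / 4" using mC by simp
    finally have rest: "norm (integral {?a..t} ?f) \<le> \<epsilon> / 4" .
    have "k * (\<epsilon>' / m + 2 * \<eta> * C) \<le> (T * m) * (\<epsilon>' / m + 2 * \<eta> * C)"
      using kT \<open>\<epsilon>' > 0\<close> \<open>\<eta> > 0\<close> C(1) by (intro mult_right_mono) (auto intro: add_nonneg_nonneg simp del: of_nat_mult)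
    also have "\<dots> = T * \<epsilon>' + 2 * (\<eta> * (C * (real T * m)))"
      using m0 by (simp add: field_simps)
    also have "T * \<epsilon>' \<le> \<epsilon> / 4"
      using \<open>0 < \<epsilon>\<close> by (simp add: \<epsilon>'_def field_simps)
    also have "\<eta> * (C * (real T * m)) \<le> \<eta> * (C * (real T * m + 1))"
      using \<open>\<eta> > 0\<close> C(1) by (intro mult_left_mono) auto
    also have "\<eta> * (C * (real T * m + 1)) = \<epsilon> / 8"
    proof -
      have "\<epsilon> / (8 * x) * x = \<epsilon> / 8" if "0 < x" for x using that by simp
      from this[OF D0] show ?thesis unfolding \<eta>_def mult.assoc .
    qed
    finally have total: "k * (\<epsilon>' / m + 2 * \<eta> * C) \<le> \<epsilon> / 4 + 2 * (\<epsilon> / 8)" by simp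
    have "norm (integral {0..?a} ?f) \<le> \<epsilon> / 2"
      using order_trans[OF blocks[OF kT] total] by simp
    moreover have "integral {0..t} ?f = integral {0..?a} ?f + integral {?a..t} ?f"
      using a t by (intro Henstock_Kurzweil_Integration.integral_combine[symmetric] fi) auto
    ultimately show "norm (integral {0..t} ?f) \<le> \<epsilon>"
      using rest norm_triangle_ineq[of "integral {0..?a} ?f" "integral {?a..t} ?f"] \<open>0 < \<epsilon>\<close> by simp
  qed
qed

section \<open>Mixed forces and continuity in the occupation times\<close>

text \<open>
  Times after \<open>T\<close> contribute at most \<open>exp (- T)\<close> to the distance, since the supremum is capped at
  \<open>1\<close>. So the path metric only needs estimates on compact time intervals.
\<close>

lemma dist_cpath_le:
  assumes "0 \<le> T" and close: "\<And>t. t \<in> {0..T} \<Longrightarrow> norm (cpath_at z t - cpath_at w t) \<le> \<epsilon>"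
  shows "dist z w \<le> \<epsilon> + exp (- T)"
proof -
  have "0 \<le> \<epsilon>" using order_trans[OF norm_ge_zero close[of 0]] \<open>0 \<le> T\<close> by simp
  have exp_int: "set_integrable lborel {c..} (\<lambda>t. exp (- t))" "(LBINT t:{c..}. exp (- t)) = exp (- c)"
    for c :: real
  proof -
    have H: "((\<lambda>t. exp (- t)) has_integral exp (- c)) {c..}"
      using has_integral_exp_minus_to_infinity[of 1 c] by simp
    have "(\<lambda>t. exp (- t)) absolutely_integrable_on {c..}"
      using H by (intro nonnegative_absolutely_integrable_1) auto
    then show I: "set_integrable lborel {c..} (\<lambda>t. exp (- t))"
      by (simp add: set_integrable_def integrable_completion)
    show "(LBINT t:{c..}. exp (- t)) = exp (- c)"
      using set_borel_integral_eq_integral(2)[OF I] integral_unique[OF H] by simp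
  qed
  have sub: "indicator {0..} t *\<^sub>R (indicator {T..} t * exp (- t)) = indicator {T..} t *\<^sub>R exp (- t)" for t :: real
    using \<open>0 \<le> T\<close> by (auto simp: indicator_def)
  have int2: "set_integrable lborel {0..} (\<lambda>t. indicator {T..} t * exp (- t))"
      "(LBINT t:{0..}. indicator {T..} t * exp (- t)) = exp (- T)"
    using exp_int[of T] unfolding set_integrable_def set_lebesgue_integral_def sub by simp_all
  have int1: "set_integrable lborel {0..} (\<lambda>t. \<epsilon> * exp (- t))"
    using exp_int(1) by simp
  have "dist z w \<le> (LBINT t:{0..}. \<epsilon> * exp (- t) + indicator {T..} t * exp (- t))"
    unfolding dist_cpath_def cpath_sup_def[symmetric]
  proof (rule set_integral_mono[OF cpath_dist_integrable])
    show "set_integrable lborel {0..} (\<lambda>t. \<epsilon> * exp (- t) + indicator {T..} t * exp (- t))"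
      by (rule set_integral_add(1)[OF int1 int2(1)])
    fix t :: real assume t: "t \<in> {0..}"
    have "min 1 (cpath_sup z w t) \<le> \<epsilon> + indicator {T..} t"
    proof (cases "t < T")
      case True
      have "cpath_sup z w t \<le> \<epsilon>"
        unfolding cpath_sup_def using t True by (intro cSUP_least close) auto
      then show ?thesis by (auto simp: indicator_def)
    qed (use \<open>0 \<le> \<epsilon>\<close> in auto)
    then have "exp (- t) * min 1 (cpath_sup z w t) \<le> exp (- t) * (\<epsilon> + indicator {T..} t)"
      by (intro mult_left_mono) auto
    then show "exp (- t) * min 1 (cpath_sup z w t) \<le> \<epsilon> * exp (- t) + indicator {T..} t * exp (- t)"
      by (simp add: algebra_simps)
  qed
  also have "\<dots> = (LBINT t:{0..}. \<epsilon> * exp (- t)) + (LBINT t:{0..}. indicator {T..} t * exp (- t))"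
    by (rule set_integral_add(2)[OF int1 int2(1)])
  also have "\<dots> = \<epsilon> + exp (- T)"
    using exp_int(2)[of 0] int2(2) by simp
  finally show ?thesis .
qed

text \<open>
  Such weights are the relaxed controls of control theory: a curve of probability distributions on
  the index set. They put a randomly switched force and the averaged force into one class of
  systems.
\<close>

definition mixing_weights :: "(real \<Rightarrow> 'n::finite \<Rightarrow> real) \<Rightarrow> bool" where
  "mixing_weights w \<longleftrightarrow>
     (\<forall>t\<ge>0. (\<forall>j. 0 \<le> w t j) \<and> (\<Sum>j\<in>UNIV. w t j) = 1) \<and>
     (\<forall>j. \<forall>t\<ge>0. (\<lambda>s. w s j) integrable_on {0..t})"

definition mixed_force ::
  "('n::finite \<Rightarrow> 'a \<Rightarrow> 'a) \<Rightarrow> (real \<Rightarrow> 'n \<Rightarrow> real) \<Rightarrow> real \<Rightarrow> 'a \<Rightarrow> 'a::real_vector" where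
  "mixed_force g w t x = (\<Sum>j\<in>UNIV. w t j *\<^sub>R g j x)"

definition occupation :: "(real \<Rightarrow> 'n \<Rightarrow> real) \<Rightarrow> 'n \<Rightarrow> real \<Rightarrow> real" where
  "occupation w j t = integral {0..t} (\<lambda>s. w s j)"

lemma mixing_weights_bounds:
  assumes "mixing_weights w" "0 \<le> t"
  shows "0 \<le> w t j" "w t j \<le> 1"
proof -
  show "0 \<le> w t j" using assms by (auto simp: mixing_weights_def)
  have "w t j \<le> (\<Sum>j\<in>UNIV. w t j)"
    using assms by (intro member_le_sum) (auto simp: mixing_weights_def)
  then show "w t j \<le> 1" using assms by (auto simp: mixing_weights_def)
qed

text \<open>
  A convex combination of \<open>L\<close>-Lipschitz maps is \<open>L\<close>-Lipschitz, so the constant is uniform over all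
  weights.
\<close>

lemma norm_mixed_force_diff_le:
  assumes "mixing_weights w" "0 \<le> t" and lip: "\<And>j. L-lipschitz_on UNIV (g j)"
  shows "norm (mixed_force g w t x - mixed_force g w t y) \<le> L * norm (x - y)"
proof -
  have "mixed_force g w t x - mixed_force g w t y = (\<Sum>j\<in>UNIV. w t j *\<^sub>R (g j x - g j y))"
    by (simp add: mixed_force_def scaleR_diff_right sum_subtractf)
  also have "norm \<dots> \<le> (\<Sum>j\<in>UNIV. w t j * (L * norm (x - y)))"
  proof (rule sum_norm_le)
    fix j
    show "norm (w t j *\<^sub>R (g j x - g j y)) \<le> w t j * (L * norm (x - y))"
      using lipschitz_onD[OF lip[of j], of x y] mixing_weights_bounds(1)[OF assms(1,2), of j]
      by (simp add: dist_norm mult_left_mono)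
  qed
  also have "\<dots> = L * norm (x - y)"
    using assms(1,2) by (simp add: mixing_weights_def flip: sum_distrib_right)
  finally show ?thesis .
qed

text \<open>
  The horizon \<open>T\<close> absorbs half of \<open>\<epsilon>\<close> through the tail of the metric, and the defect is made at most
  the other half divided by the Gronwall factor. The test functions \<open>g j (q s)\<close> come from the
  fixed solution only, so \<open>S\<close> and \<open>\<eta>\<close> work for all competing weights at once.
\<close>

lemma solution_continuous_in_occupation:
  fixes g :: "'n::finite \<Rightarrow> 'a::euclidean_space \<Rightarrow> 'a"
  assumes lip: "\<And>j. L-lipschitz_on UNIV (g j)" and "0 \<le> \<alpha>"
    and w: "mixing_weights w" and sol: "momentum_solution (mixed_force g w) \<alpha> q0 p0 q p"
    and "0 < \<epsilon>"
  obtains S :: "rat set" and \<eta> :: real where "finite S" "S \<subseteq> {0..}" "0 < \<eta>"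
    "\<forall>w' q' p'. mixing_weights w' \<longrightarrow> momentum_solution (mixed_force g w') \<alpha> q0 p0 q' p' \<longrightarrow>
      (\<forall>r\<in>S. \<forall>j. \<bar>occupation w' j (of_rat r) - occupation w j (of_rat r)\<bar> < \<eta>) \<longrightarrow>
      dist (to_cpath (\<lambda>t. (p' t, q' t))) (to_cpath (\<lambda>t. (p t, q t))) < \<epsilon>"
proof -
  have "0 \<le> L" using lip by (rule lipschitz_on_nonneg)
  \<comment> \<open>With this horizon the tail \<open>exp (- T)\<close> of the metric is below \<open>\<epsilon> / 2\<close>.\<close>
  obtain T :: nat where T: "real T > - ln (\<epsilon> / 2)"
    using reals_Archimedean2 by blast
  then have "- real T < ln (\<epsilon> / 2)" by simp
  then have expT: "exp (- real T) < \<epsilon> / 2"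
    using \<open>0 < \<epsilon>\<close> by (metis exp_less_mono exp_ln half_gt_zero)
  define K where "K = 2 * (1 + L + \<alpha>)"
  have "0 \<le> K" using \<open>0 \<le> L\<close> \<open>0 \<le> \<alpha>\<close> by (simp add: K_def)
  \<comment> \<open>A defect of size \<open>\<epsilon>'\<close> is amplified to \<open>2 * \<epsilon>' * exp (K * T) = \<epsilon> / 2\<close>.\<close>
  define \<epsilon>' where "\<epsilon>' = \<epsilon> / 4 * exp (- (K * real T))"
  define \<delta> where "\<delta> = \<epsilon>' / real CARD('n)"
  have "\<delta> > 0" using \<open>0 < \<epsilon>\<close> by (simp add: \<delta>_def \<epsilon>'_def)
  have cont: "continuous_on {0..} q" "continuous_on {0..} p"
    using sol by (auto simp: momentum_solution_def)
  have G: "continuous_on {0..real T} (\<lambda>s. g j (q s))" for j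
  proof (rule continuous_on_compose2[of UNIV "g j"])
    show "continuous_on UNIV (g j)" using lip by (rule lipschitz_on_continuous_on)
    show "continuous_on {0..real T} q" using cont(1) by (rule continuous_on_subset) auto
  qed simp
  define good where "good j S \<eta> \<longleftrightarrow> finite S \<and> S \<subseteq> {0..} \<and> 0 < \<eta> \<and>
      (\<forall>h t. h integrable_on {0..real T} \<longrightarrow> (\<forall>s\<in>{0..real T}. \<bar>h s\<bar> \<le> 1) \<longrightarrow>
        (\<forall>r\<in>S. \<bar>integral {0..of_rat r} h\<bar> < \<eta>) \<longrightarrow> t \<in> {0..real T} \<longrightarrow>
        norm (integral {0..t} (\<lambda>s. h s *\<^sub>R g j (q s))) \<le> \<delta>)"
    for j and S :: "rat set" and \<eta> :: real
  have "\<exists>S \<eta>. good j S \<eta>" for j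
  proof (rule small_primitive_imp_small_weighted_integral[OF G[of j] \<open>\<delta> > 0\<close>], intro exI)
    fix S \<eta>
    assume "finite S" "S \<subseteq> {0..}" "0 < \<eta>"
      and "\<And>h t. \<lbrakk>h integrable_on {0..real T}; \<And>s. s \<in> {0..real T} \<Longrightarrow> \<bar>h s\<bar> \<le> 1;
        \<And>r. r \<in> S \<Longrightarrow> \<bar>integral {0..of_rat r} h\<bar> < \<eta>; t \<in> {0..real T}\<rbrakk>
      \<Longrightarrow> norm (integral {0..t} (\<lambda>s. h s *\<^sub>R g j (q s))) \<le> \<delta>"
    then show "good j S \<eta>" unfolding good_def by blast
  qed
  then obtain S \<eta> where good: "\<And>j. good j (S j) (\<eta> j)" by metis
  have S: "finite (S j)" "S j \<subseteq> {0..}" "0 < \<eta> j" for j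
    using good[of j] unfolding good_def by blast+
  have small: "norm (integral {0..t} (\<lambda>s. h s *\<^sub>R g j (q s))) \<le> \<delta>"
    if "h integrable_on {0..real T}" "\<And>s. s \<in> {0..real T} \<Longrightarrow> \<bar>h s\<bar> \<le> 1"
      "\<And>r. r \<in> S j \<Longrightarrow> \<bar>integral {0..of_rat r} h\<bar> < \<eta> j" "t \<in> {0..real T}" for j h t
    using good[of j] that unfolding good_def by blast
  show thesis
  proof (rule that; (intro allI impI)?)
    show "finite (\<Union>j. S j)" using S by auto
    show "(\<Union>j. S j) \<subseteq> {0..}" using S(2) by blast
    show "0 < Min (range \<eta>)" using S by auto
    fix w' q' p'
    assume w': "mixing_weights w'" and sol': "momentum_solution (mixed_force g w') \<alpha> q0 p0 q' p'"
      and close: "\<forall>r\<in>\<Union>j. S j. \<forall>j.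
        \<bar>occupation w' j (of_rat r) - occupation w j (of_rat r)\<bar> < Min (range \<eta>)"
    define h where "h j s = w' s j - w s j" for j s
    have wi: "(\<lambda>s. w' s j) integrable_on {0..t}" "(\<lambda>s. w s j) integrable_on {0..t}" for j t
      using w w' integrable_on_empty by (cases "0 \<le> t"; auto simp: mixing_weights_def)+
    have h: "h j integrable_on {0..t}" for j t
      unfolding h_def by (intro integrable_diff wi)
    have h1: "\<bar>h j s\<bar> \<le> 1" if "s \<ge> 0" for j s
      unfolding h_def using mixing_weights_bounds[OF w that, of j] mixing_weights_bounds[OF w' that, of j]
      by linarith
    have err: "norm (integral {0..t} (\<lambda>s. h j s *\<^sub>R g j (q s))) \<le> \<delta>" if "t \<in> {0..real T}" for j t
    proof (rule small[OF h _ _ that])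
      fix r assume r: "r \<in> S j"
      have "integral {0..of_rat r} (h j) = occupation w' j (of_rat r) - occupation w j (of_rat r)"
        unfolding h_def occupation_def by (intro integral_diff wi)
      moreover have "Min (range \<eta>) \<le> \<eta> j" by (intro Min_le) auto
      ultimately show "\<bar>integral {0..of_rat r} (h j)\<bar> < \<eta> j"
        using close r by fastforce
    qed (use h1 in auto)
    define e where "e t = (\<Sum>j\<in>UNIV. integral {0..t} (\<lambda>s. h j s *\<^sub>R g j (q s)))" for t
    have e: "((\<lambda>s. mixed_force g w' s (q s) - mixed_force g w s (q s)) has_integral e t) {0..t}"
      if "t \<in> {0..real T}" for t
    proof -
      have "(\<lambda>s. h j s *\<^sub>R g j (q s)) integrable_on {0..t}" for j
        using h1 that by (intro integrable_on_scaleR_continuous[where B = 1] h continuous_on_subset[OF G]) auto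
      then have "((\<lambda>s. \<Sum>j\<in>UNIV. h j s *\<^sub>R g j (q s)) has_integral e t) {0..t}"
        unfolding e_def by (intro has_integral_sum integrable_integral) auto
      then show ?thesis
        by (simp add: mixed_force_def h_def scaleR_diff_left sum_subtractf)
    qed
    have e_le: "norm (e t) \<le> \<epsilon>'" if "t \<in> {0..real T}" for t
    proof -
      have "norm (e t) \<le> (\<Sum>j\<in>(UNIV::'n set). \<delta>)"
        unfolding e_def by (intro sum_norm_le err that)
      then show ?thesis by (simp add: \<delta>_def)
    qed
    have cont': "continuous_on {0..} q'" "continuous_on {0..} p'"
      using sol' by (auto simp: momentum_solution_def)
    have "norm (cpath_at (to_cpath (\<lambda>t. (p' t, q' t))) t - cpath_at (to_cpath (\<lambda>t. (p t, q t))) t) \<le> \<epsilon> / 2"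
      if t: "t \<in> {0..real T}" for t
    proof -
      have "norm (cpath_at (to_cpath (\<lambda>t. (p' t, q' t))) t - cpath_at (to_cpath (\<lambda>t. (p t, q t))) t)
          = norm (p' t - p t, q' t - q t)"
        using t by (simp add: cpath_at_to_cpath cont cont' continuous_on_Pair)
      also have "\<dots> \<le> norm (q' t - q t) + norm (p' t - p t)"
        using norm_Pair_le[of "p' t - p t" "q' t - q t"] by simp
      also have "\<dots> \<le> 2 * \<epsilon>' * exp (K * t)"
        unfolding K_def
        by (rule momentum_solution_stable[OF sol sol' norm_mixed_force_diff_le[OF w' _ lip]
              \<open>0 \<le> L\<close> \<open>0 \<le> \<alpha>\<close> e e_le t]) auto
      also have "\<dots> \<le> 2 * \<epsilon>' * exp (K * real T)"
        using t \<open>0 \<le> K\<close> \<open>0 < \<epsilon>\<close> by (intro mult_left_mono) (auto simp: \<epsilon>'_def mult_left_mono)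
      also have "\<dots> = \<epsilon> / 2"
        by (simp add: \<epsilon>'_def mult.assoc flip: exp_add)
      finally show ?thesis .
    qed
    from dist_cpath_le[where T = "real T", OF _ this]
    show "dist (to_cpath (\<lambda>t. (p' t, q' t))) (to_cpath (\<lambda>t. (p t, q t))) < \<epsilon>"
      using expT by simp
  qed
qed

section \<open>Riemann sums of right-continuous functions\<close>

text \<open>
  The step function takes on each cell the value of \<open>\<phi>\<close> at the right end point of the cell, so
  that right-continuity of \<open>\<phi>\<close> is enough for convergence as the mesh shrinks.
\<close>

lemma has_integral_right_step:
  fixes \<phi> :: "real \<Rightarrow> real"
  assumes "0 < \<delta>"
  shows "((\<lambda>s. \<phi> (\<delta> * (of_int \<lfloor>s / \<delta>\<rfloor> + 1))) has_integral (\<Sum>k<n. \<delta> * \<phi> (\<delta> * (real k + 1)))) {0..\<delta> * real n}"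
    (is "(?f has_integral _) _")
proof (induction n)
  case 0
  then show ?case by (simp add: has_integral_refl)
next
  case (Suc n)
  let ?a = "\<delta> * real n" and ?b = "\<delta> * real (Suc n)"
  have ab: "0 \<le> ?a" "?a \<le> ?b" "?b - ?a = \<delta>" using assms by (auto simp: algebra_simps)
  have "((\<lambda>_. \<phi> (\<delta> * (real n + 1))) has_integral ((?b - ?a) *\<^sub>R \<phi> (\<delta> * (real n + 1)))) {?a..?b}"
    using has_integral_const_real[of "\<phi> (\<delta> * (real n + 1))" ?a ?b] ab by simp
  then have "(?f has_integral (\<delta> * \<phi> (\<delta> * (real n + 1)))) {?a..?b}"
  proof (rule has_integral_spike_finite[where S = "{?b}", rotated 2, THEN has_integral_eq_rhs])
    fix s assume s: "s \<in> {?a..?b} - {?b}"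
    then have "real n \<le> s / \<delta>" "s / \<delta> < real n + 1"
      using assms by (auto simp: field_simps)
    then have "\<lfloor>s / \<delta>\<rfloor> = int n" by (intro floor_unique) auto
    then show "?f s = \<phi> (\<delta> * (real n + 1))" by simp
  qed (use ab in auto)
  from has_integral_combine[OF ab(1,2) Suc this] show ?case by simp
qed

text \<open>
  Dominated convergence along the step functions with mesh \<open>T / Suc n\<close> gives integrability and the
  limit of the sums together. The sums reduce statements on integrals along sample paths to finite
  sums of random variables, which replaces joint measurability in time and chance.
\<close>

lemma right_continuous_Riemann_sums:
  fixes \<phi> :: "real \<Rightarrow> real"
  assumes rc: "\<And>s. 0 \<le> s \<Longrightarrow> (\<phi> \<longlongrightarrow> \<phi> s) (at_right s)"
    and b: "\<And>s. 0 \<le> s \<Longrightarrow> \<bar>\<phi> s\<bar> \<le> B" and "0 < T"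
  shows "\<phi> integrable_on {0..T}"
    and "(\<lambda>n. \<Sum>k<Suc n. T / Suc n * \<phi> (T / Suc n * (real k + 1))) \<longlonglongrightarrow> integral {0..T} \<phi>"
proof -
  define \<delta> where "\<delta> n = T / Suc n" for n :: nat
  define f where "f n s = \<phi> (\<delta> n * (of_int \<lfloor>s / \<delta> n\<rfloor> + 1))" for n s
  have \<delta>0: "\<delta> n > 0" for n using \<open>0 < T\<close> by (simp add: \<delta>_def)
  have \<delta>_lim: "\<delta> \<longlonglongrightarrow> 0"
    unfolding \<delta>_def using LIMSEQ_Suc[OF lim_const_over_n[of T]] .
  have T: "\<delta> n * real (Suc n) = T" for n by (simp add: \<delta>_def)
  have fint: "(f n has_integral (\<Sum>k<Suc n. \<delta> n * \<phi> (\<delta> n * (real k + 1)))) {0..T}" for n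
    using has_integral_right_step[OF \<delta>0[of n], of \<phi> "Suc n"] unfolding T f_def .
  have nxt: "s < \<delta> n * (of_int \<lfloor>s / \<delta> n\<rfloor> + 1)" "\<delta> n * (of_int \<lfloor>s / \<delta> n\<rfloor> + 1) \<le> s + \<delta> n" for s n
  proof -
    have "s / \<delta> n < of_int \<lfloor>s / \<delta> n\<rfloor> + 1" "of_int \<lfloor>s / \<delta> n\<rfloor> + 1 \<le> s / \<delta> n + 1" by linarith+
    then show "s < \<delta> n * (of_int \<lfloor>s / \<delta> n\<rfloor> + 1)" "\<delta> n * (of_int \<lfloor>s / \<delta> n\<rfloor> + 1) \<le> s + \<delta> n"
      using \<delta>0[of n] by (simp_all add: field_simps)
  qed
  have conv: "(\<lambda>n. f n s) \<longlonglongrightarrow> \<phi> s" if "s \<in> {0..T}" for s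
  proof -
    have "(\<lambda>n. \<delta> n * (of_int \<lfloor>s / \<delta> n\<rfloor> + 1)) \<longlonglongrightarrow> s"
    proof (rule tendsto_sandwich)
      show "(\<lambda>_. s) \<longlonglongrightarrow> s" "(\<lambda>n. s + \<delta> n) \<longlonglongrightarrow> s"
        using tendsto_add[OF tendsto_const \<delta>_lim, of s] by auto
    qed (use nxt in \<open>auto intro!: always_eventually less_imp_le\<close>)
    then have "filterlim (\<lambda>n. \<delta> n * (of_int \<lfloor>s / \<delta> n\<rfloor> + 1)) (at_right s) sequentially"
      using nxt(1) by (auto simp: filterlim_at intro!: always_eventually less_imp_neq[THEN not_sym])
    then show ?thesis
      unfolding f_def using that by (intro filterlim_compose[OF rc]) auto
  qed
  have le: "norm (f n s) \<le> B" if "s \<in> {0..T}" for n s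
    unfolding f_def real_norm_def using that nxt(1)[of s n] by (intro b) auto
  have fi: "f n integrable_on {0..T}" for n using fint by (rule has_integral_integrable)
  have ci: "(\<lambda>_. B) integrable_on {0..T}" by (rule integrable_const_ivl)
  show "\<phi> integrable_on {0..T}"
    using dominated_convergence(1)[OF fi ci le conv] by auto
  show "(\<lambda>n. \<Sum>k<Suc n. T / Suc n * \<phi> (T / Suc n * (real k + 1))) \<longlonglongrightarrow> integral {0..T} \<phi>"
    using dominated_convergence(2)[OF fi ci le conv] unfolding integral_unique[OF fint] \<delta>_def by auto
qed

section \<open>Covariances of the index process\<close>

text \<open>
  The matrix \<open>P\<close> is the orthogonal projection onto the vectors with coordinate sum zero.
\<close>

lemma matrix_power_generator:
  fixes c :: real
  defines "P \<equiv> (\<chi> i j. of_bool (i = j) - 1 / real CARD('n)) :: real^'n^'n::finite"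
  shows "((**) (c *\<^sub>R P) ^^ Suc k) (mat 1) = c ^ Suc k *\<^sub>R P"
proof (induction k)
  case 0
  then show ?case by (simp add: matrix_mul_rid)
next
  case (Suc k)
  define r where "r = 1 / real CARD('n)"
  have PP: "(\<Sum>l\<in>UNIV. P $ i $ l * P $ l $ j) = P $ i $ j" for i j
  proof -
    have "(\<Sum>l\<in>UNIV. P $ i $ l * P $ l $ j) = (\<Sum>l\<in>UNIV. (if l = i then of_bool (i = j) else 0)
        - (if l = i then r else 0) - (if l = j then r else 0) + r * r)"
      by (intro sum.cong) (auto simp: P_def r_def[symmetric] algebra_simps)
    also have "\<dots> = of_bool (i = j) - r - r + real CARD('n) * (r * r)"
      by (simp add: sum.distrib sum_subtractf)
    also have "real CARD('n) * (r * r) = r" by (simp add: r_def)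
    finally show ?thesis by (simp add: P_def r_def)
  qed
  have "(c *\<^sub>R P) ** (d *\<^sub>R P) = (c * d) *\<^sub>R P" for d
  proof -
    have "(\<Sum>l\<in>UNIV. c * P $ i $ l * (d * P $ l $ j)) = c * d * (\<Sum>l\<in>UNIV. P $ i $ l * P $ l $ j)" for i j
      by (simp add: sum_distrib_left mult_ac)
    then show ?thesis by (simp add: vec_eq_iff matrix_matrix_mult_def PP)
  qed
  then show ?case using Suc by simp
qed

text \<open>
  With the projection \<open>P\<close> of \<open>matrix_power_generator\<close> the rate matrix is \<open>- N * \<gamma>\<close> times \<open>P\<close>, so
  in the exponential series all positive powers are multiples of \<open>P\<close>, and the identity splits as
  \<open>P\<close> plus the matrix \<open>R\<close> of uniform transition probabilities.
\<close>

lemma matrix_exp_generator: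
  "matrix_exp (t *\<^sub>R ((\<chi> i j. \<gamma>) - (real CARD('n) * \<gamma>) *\<^sub>R mat 1) :: real^'n^'n::finite) $ x $ y =
    1 / real CARD('n) + exp (- (real CARD('n) * \<gamma> * t)) * (of_bool (x = y) - 1 / real CARD('n))"
proof -
  define P :: "real^'n^'n" where "P = (\<chi> i j. of_bool (i = j) - 1 / real CARD('n))"
  define R :: "real^'n^'n" where "R = (\<chi> i j. 1 / real CARD('n))"
  define c where "c = - (real CARD('n) * \<gamma> * t)"
  have A: "t *\<^sub>R ((\<chi> i j. \<gamma>) - (real CARD('n) * \<gamma>) *\<^sub>R mat 1) = c *\<^sub>R P"
    by (simp add: vec_eq_iff P_def c_def mat_def field_simps of_bool_def)
  have pow: "((**) (c *\<^sub>R P) ^^ k) (mat 1) = c ^ k *\<^sub>R P + (if k = 0 then R else 0)" for k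
  proof (cases k)
    case 0
    then show ?thesis by (simp add: P_def R_def mat_def vec_eq_iff)
  qed (use matrix_power_generator[where c = c and 'n = 'n] in \<open>simp add: P_def del: funpow.simps\<close>)
  have "(\<lambda>k. (1 / fact k) * c ^ k) sums exp c"
    using exp_converges[of c] by (simp add: field_simps)
  then have "(\<lambda>k. ((1 / fact k) * c ^ k) *\<^sub>R P) sums (exp c *\<^sub>R P)"
    by (intro bounded_linear.sums[OF bounded_linear_scaleR_left])
  moreover have "(\<lambda>k. if k = 0 then R else 0) sums R" by (rule sums_single)
  ultimately have "(\<lambda>k. ((1 / fact k) * c ^ k) *\<^sub>R P + (if k = 0 then R else 0)) sums (exp c *\<^sub>R P + R)"
    by (rule sums_add)
  also have "(\<lambda>k. ((1 / fact k) * c ^ k) *\<^sub>R P + (if k = 0 then R else 0))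
      = (\<lambda>k. (1 / fact k) *\<^sub>R ((**) (c *\<^sub>R P) ^^ k) (mat 1))"
    unfolding pow by (auto simp: scaleR_add_right)
  finally have "matrix_exp (c *\<^sub>R P) = exp c *\<^sub>R P + R"
    unfolding matrix_exp_def by (simp add: sums_iff)
  then show ?thesis unfolding A by (simp add: P_def R_def c_def)
qed
context prob_space
begin

lemma index_process_measurable:
  assumes "index_process M \<gamma> X" "0 \<le> t"
  shows "X t \<in> measurable M (count_space UNIV)"
  using assms by (simp add: index_process_def markov_chain_with_rates_def)

text \<open>
  This is the Markov property integrated over the event \<open>X s = x\<close>, which belongs to the natural
  filtration at time \<open>s\<close>.
\<close>

lemma index_process_two_point:
  fixes X :: "real \<Rightarrow> 'a \<Rightarrow> 'n::finite"
  assumes X: "index_process M \<gamma> X" and "0 \<le> s" "0 \<le> t"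
  shows "prob {\<omega>\<in>space M. X s \<omega> = x \<and> X (s + t) \<omega> = y} = prob {\<omega>\<in>space M. X s \<omega> = x} *
    (1 / real CARD('n) + exp (- (real CARD('n) * \<gamma> * t)) * (of_bool (x = y) - 1 / real CARD('n)))"
proof -
  let ?F = "natural_filtration M X s"
  let ?A = "{\<omega>\<in>space M. X s \<omega> = x}" and ?B = "{\<omega>\<in>space M. X (s + t) \<omega> = y}"
  let ?c = "1 / real CARD('n) + exp (- (real CARD('n) * \<gamma> * t)) * (of_bool (x = y) - 1 / real CARD('n))"
  have [measurable]: "X u \<in> measurable M (count_space UNIV)" if "0 \<le> u" for u
    using index_process_measurable[OF X that] .
  have m: "X u -` {z} \<inter> space M \<in> sets M" if "0 \<le> u" for u z
    using that by (intro measurable_sets[where A = "count_space UNIV"]) auto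
  let ?G = "{X u -` {z} \<inter> space M | u z. 0 \<le> u \<and> u \<le> s}"
  have "?G \<subseteq> Pow (space M)" by blast
  then have F_sets: "space ?F = space M" "sets ?F = sigma_sets (space M) ?G"
    unfolding natural_filtration_def by (rule space_measure_of, rule sets_measure_of)
  have "?G \<subseteq> sets M" using m by blast
  then have sub: "subalgebra M ?F"
    unfolding subalgebra_def F_sets by (intro conjI refl sets.sigma_sets_subset)
  interpret F: finite_measure_subalgebra M ?F
    by unfold_locales (rule sub)
  have "X s -` {x} \<inter> space M \<in> ?G"
    using \<open>0 \<le> s\<close> by blast
  moreover have "X s -` {x} \<inter> space M = ?A" by auto
  ultimately have AF: "?A \<in> sets ?F"
    unfolding F_sets by (simp add: sigma_sets.Basic)
  have A: "?A \<in> sets M" and B: "?B \<in> sets M"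
    using m[of s x] m[of "s + t" y] \<open>0 \<le> s\<close> \<open>0 \<le> t\<close> by (auto simp: vimage_def Int_def conj_commute)
  have "prob {\<omega>\<in>space M. X s \<omega> = x \<and> X (s + t) \<omega> = y} = prob (?A \<inter> ?B)"
    by (intro arg_cong[where f = prob]) auto
  also have "\<dots> = (\<integral>\<omega>\<in>?A. indicator ?B \<omega> \<partial>M)"
    unfolding set_lebesgue_integral_def using A B
    by (simp flip: indicator_inter_arith)
  also have "\<dots> = (\<integral>\<omega>\<in>?A. real_cond_exp M ?F (indicator ?B) \<omega> \<partial>M)"
    using B by (intro F.real_cond_exp_intA AF) (auto intro!: integrable_real_indicator simp: emeasure_eq_measure)
  also have "\<dots> = expectation (\<lambda>\<omega>. indicator ?A \<omega> * ?c)"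
    unfolding set_lebesgue_integral_def
  proof (rule integral_cong_AE)
    have "AE \<omega> in M. real_cond_exp M ?F (indicator ?B) \<omega>
        = matrix_exp (t *\<^sub>R ((\<chi> i j. \<gamma>) - (real CARD('n) * \<gamma>) *\<^sub>R mat 1)) $ X s \<omega> $ y"
      using X \<open>0 \<le> s\<close> \<open>0 \<le> t\<close> by (simp add: index_process_def markov_chain_with_rates_def)
    then show "AE \<omega> in M. indicator ?A \<omega> *\<^sub>R real_cond_exp M ?F (indicator ?B) \<omega> = indicator ?A \<omega> * ?c"
      by eventually_elim (simp add: matrix_exp_generator indicator_def)
  qed (use A in simp_all)
  also have "\<dots> = prob ?A * ?c"
    using A by simp
  finally show ?thesis .
qed

text \<open>The columns of the transition matrix sum to one, so the uniform law is stationary.\<close>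

lemma index_process_uniform:
  fixes X :: "real \<Rightarrow> 'a \<Rightarrow> 'n::finite"
  assumes X: "index_process M \<gamma> X" and "0 \<le> t"
  shows "prob {\<omega>\<in>space M. X t \<omega> = y} = 1 / real CARD('n)"
proof -
  note [measurable] = index_process_measurable[OF X]
  have start: "prob {\<omega>\<in>space M. X 0 \<omega> = x} = 1 / real CARD('n)" for x
  proof -
    have "prob {\<omega>\<in>space M. X 0 \<omega> = x} = measure (distr M (count_space UNIV) (X 0)) {x}"
      by (subst measure_distr) (auto intro!: arg_cong[where f = prob] index_process_measurable[OF X])
    also have "\<dots> = 1 / real CARD('n)"
      using X by (simp add: index_process_def measure_uniform_count_measure)
    finally show ?thesis .
  qed
  let ?e = "exp (- (real CARD('n) * \<gamma> * t))"
  have "prob {\<omega>\<in>space M. X t \<omega> = y} = prob (\<Union>x\<in>UNIV. {\<omega>\<in>space M. X 0 \<omega> = x \<and> X (0 + t) \<omega> = y})"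
    by (intro arg_cong[where f = prob]) auto
  also have "\<dots> = (\<Sum>x\<in>UNIV. prob {\<omega>\<in>space M. X 0 \<omega> = x \<and> X (0 + t) \<omega> = y})"
  proof (intro finite_measure_finite_Union)
    show "(\<lambda>x. {\<omega>\<in>space M. X 0 \<omega> = x \<and> X (0 + t) \<omega> = y}) ` UNIV \<subseteq> events"
      using \<open>0 \<le> t\<close> by auto
  qed (auto simp: disjoint_family_on_def)
  also have "\<dots> = (\<Sum>x\<in>UNIV. 1 / real CARD('n) * (1 / real CARD('n) + ?e * (of_bool (x = y) - 1 / real CARD('n))))"
    using index_process_two_point[OF X order_refl \<open>0 \<le> t\<close>] start by simp
  also have "\<dots> = 1 / real CARD('n)"
    by (simp add: sum.distrib sum_subtractf flip: sum_distrib_left sum_divide_distrib)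
  finally show ?thesis .
qed

lemma index_process_covariance_le:
  fixes X :: "real \<Rightarrow> 'a \<Rightarrow> 'n::finite"
  assumes X: "index_process M \<gamma> X" and "0 \<le> s" "s \<le> t"
  shows "expectation (\<lambda>\<omega>. (of_bool (X s \<omega> = j) - 1 / real CARD('n)) * (of_bool (X t \<omega> = j) - 1 / real CARD('n)))
    \<le> exp (- (real CARD('n) * \<gamma> * (t - s)))"
proof -
  note [measurable] = index_process_measurable[OF X]
  have "0 \<le> t" using assms by simp
  define c where "c = 1 / real CARD('n)"
  define e where "e = exp (- (real CARD('n) * \<gamma> * (t - s)))"
  have c: "0 \<le> c" "c \<le> 1" by (simp_all add: c_def)
  let ?A = "{\<omega>\<in>space M. X s \<omega> = j}" and ?B = "{\<omega>\<in>space M. X t \<omega> = j}"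
  have sets [simp]: "?A \<in> events" "?B \<in> events" using \<open>0 \<le> s\<close> \<open>0 \<le> t\<close> by measurable
  have A: "prob ?A = c" and B: "prob ?B = c"
    unfolding c_def using X \<open>0 \<le> s\<close> \<open>0 \<le> t\<close> by (auto intro!: index_process_uniform)
  have "?A \<inter> ?B = {\<omega>\<in>space M. X s \<omega> = j \<and> X (s + (t - s)) \<omega> = j}" by auto
  then have AB: "prob (?A \<inter> ?B) = c * (c + e * (1 - c))"
    using index_process_two_point[OF X \<open>0 \<le> s\<close>, of "t - s" j j] A \<open>s \<le> t\<close>
    by (simp add: c_def e_def)
  have "expectation (\<lambda>\<omega>. (of_bool (X s \<omega> = j) - c) * (of_bool (X t \<omega> = j) - c))
    = expectation (\<lambda>\<omega>. indicator (?A \<inter> ?B) \<omega> - c * indicator ?A \<omega> - c * indicator ?B \<omega> + c * c)"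
  proof (rule Bochner_Integration.integral_cong[OF refl])
    fix \<omega> assume "\<omega> \<in> space M"
    then show "(of_bool (X s \<omega> = j) - c) * (of_bool (X t \<omega> = j) - c)
        = indicator (?A \<inter> ?B) \<omega> - c * indicator ?A \<omega> - c * indicator ?B \<omega> + c * c"
      by (cases "X s \<omega> = j"; cases "X t \<omega> = j") (simp_all add: algebra_simps)
  qed
  also have "\<dots> = prob (?A \<inter> ?B) - c * prob ?A - c * prob ?B + c * c"
    by (simp add: prob_space emeasure_eq_measure sets.Int del: Int_iff)
  also have "\<dots> = e * (c * (1 - c))"
    unfolding AB A B by (simp add: algebra_simps)
  also have "\<dots> \<le> e * 1"
    using c by (intro mult_left_mono mult_le_one) (auto simp: e_def)
  finally show ?thesis by (simp add: c_def e_def)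
qed

end

section \<open>Occupation times of the fast index process\<close>

lemma exp_ratio_le: "0 < x \<Longrightarrow> exp (- x) / (1 - exp (- x)) \<le> 1 / (x::real)"
proof -
  assume "0 < x"
  have "1 + x \<le> exp x" by (rule exp_ge_add_one_self)
  then have "1 / (exp x - 1) \<le> 1 / x" using \<open>0 < x\<close> by (intro divide_left_mono mult_pos_pos) linarith+
  moreover have "exp (- x) / (1 - exp (- x)) = 1 / (exp x - 1)"
    using \<open>0 < x\<close> by (simp add: exp_minus field_simps)
  ultimately show ?thesis by simp
qed

context prob_space
begin

text \<open>
  Adding \<open>\<psi> n\<close> to the sum increases the second moment by at most one for the square of \<open>\<psi> n\<close> and
  by twice a geometric series for the mixed terms.
\<close>

lemma expectation_square_sum_geometric:
  fixes \<psi> :: "nat \<Rightarrow> 'a \<Rightarrow> real"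
  assumes [measurable]: "\<And>k. \<psi> k \<in> borel_measurable M" and b: "\<And>k \<omega>. \<bar>\<psi> k \<omega>\<bar> \<le> 1"
    and cov: "\<And>k l. k < l \<Longrightarrow> expectation (\<lambda>\<omega>. \<psi> k \<omega> * \<psi> l \<omega>) \<le> \<rho> ^ (l - k)"
    and \<rho>: "0 \<le> \<rho>" "\<rho> < 1"
  shows "expectation (\<lambda>\<omega>. (\<Sum>k<n. \<psi> k \<omega>)\<^sup>2) \<le> real n * (1 + 2 * (\<rho> / (1 - \<rho>)))"
proof (induction n)
  case 0
  then show ?case by simp
next
  case (Suc n)
  have prod1: "\<bar>\<psi> k \<omega> * \<psi> l \<omega>\<bar> \<le> 1" for k l \<omega>
    using b[of k \<omega>] b[of l \<omega>] unfolding abs_mult by (intro mult_le_one) auto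
  have int: "integrable M (\<lambda>\<omega>. \<psi> k \<omega> * \<psi> l \<omega>)" for k l
    using prod1 by (intro integrable_const_bound[where B = 1]) auto
  have square: "(\<Sum>k<n. \<psi> k \<omega>)\<^sup>2 = (\<Sum>k<n. \<Sum>l<n. \<psi> k \<omega> * \<psi> l \<omega>)" for \<omega>
    by (simp add: power2_eq_square sum_product)
  have geo: "(\<Sum>k<n. \<rho> ^ (n - k)) \<le> \<rho> / (1 - \<rho>)" 
  proof -
    have "(\<Sum>k<n. \<rho> ^ (n - k)) = (\<Sum>k<n. \<rho> * \<rho> ^ k)"
      by (rule sum.reindex_bij_witness[where i = "\<lambda>k. n - Suc k" and j = "\<lambda>k. n - Suc k"])
        (auto simp: Suc_diff_Suc simp flip: power_Suc)
    also have "\<dots> = \<rho> * ((1 - \<rho> ^ n) / (1 - \<rho>))"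
      using \<rho> by (simp add: sum_gp_strict flip: sum_distrib_left)
    also have "\<dots> \<le> \<rho> * (1 / (1 - \<rho>))"
      using \<rho> by (intro mult_left_mono divide_right_mono) auto
    finally show ?thesis by simp
  qed
  have "expectation (\<lambda>\<omega>. (\<Sum>k<Suc n. \<psi> k \<omega>)\<^sup>2)
      = expectation (\<lambda>\<omega>. (\<Sum>k<n. \<psi> k \<omega>)\<^sup>2 + 2 * (\<Sum>k<n. \<psi> k \<omega> * \<psi> n \<omega>) + \<psi> n \<omega> * \<psi> n \<omega>)"
    by (intro Bochner_Integration.integral_cong)
      (auto simp: power2_eq_square algebra_simps sum_distrib_left sum_distrib_right)
  also have "\<dots> = expectation (\<lambda>\<omega>. (\<Sum>k<n. \<psi> k \<omega>)\<^sup>2)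
      + 2 * (\<Sum>k<n. expectation (\<lambda>\<omega>. \<psi> k \<omega> * \<psi> n \<omega>)) + expectation (\<lambda>\<omega>. \<psi> n \<omega> * \<psi> n \<omega>)"
    unfolding square using int by simp
  also have "\<dots> \<le> real n * (1 + 2 * (\<rho> / (1 - \<rho>))) + 2 * (\<rho> / (1 - \<rho>)) + 1"
  proof (intro add_mono mult_left_mono Suc.IH)
    have "(\<Sum>k<n. expectation (\<lambda>\<omega>. \<psi> k \<omega> * \<psi> n \<omega>)) \<le> (\<Sum>k<n. \<rho> ^ (n - k))"
      by (intro sum_mono cov) auto
    then show "(\<Sum>k<n. expectation (\<lambda>\<omega>. \<psi> k \<omega> * \<psi> n \<omega>)) \<le> \<rho> / (1 - \<rho>)"
      using geo by linarith
    show "expectation (\<lambda>\<omega>. \<psi> n \<omega> * \<psi> n \<omega>) \<le> 1"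
      using prod1[of n] by (intro integral_le_const int) (auto simp: abs_le_iff)
  qed simp
  also have "\<dots> = real (Suc n) * (1 + 2 * (\<rho> / (1 - \<rho>)))"
    by (simp only: of_nat_Suc distrib_right mult_1_left)
  finally show ?case .
qed

text \<open>
  The paths are locally constant to the right in the discrete topology, and the time change by
  \<open>\<nu> > 0\<close> preserves this.
\<close>

lemma index_process_right_continuous:
  assumes "index_process M \<gamma> X" "\<omega> \<in> space M" "0 < \<nu>" "0 \<le> t"
  shows "((\<lambda>s. of_bool (X (s / \<nu>) \<omega> = j) :: real) \<longlongrightarrow> of_bool (X (t / \<nu>) \<omega> = j)) (at_right t)"
proof (rule tendsto_eventually)
  have "\<forall>\<^sub>F s in at_right (t / \<nu>). X s \<omega> = X (t / \<nu>) \<omega>"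
    using assms by (simp add: index_process_def markov_chain_with_rates_def)
  moreover have "filterlim (\<lambda>s. s / \<nu>) (at_right (t / \<nu>)) (at_right t)"
  proof (unfold filterlim_at, intro conjI)
    show "((\<lambda>s. s / \<nu>) \<longlongrightarrow> t / \<nu>) (at_right t)"
      using \<open>0 < \<nu>\<close> by (intro tendsto_intros) auto
    show "\<forall>\<^sub>F s in at_right t. s / \<nu> \<in> {t / \<nu><..} \<and> s / \<nu> \<noteq> t / \<nu>"
      using \<open>0 < \<nu>\<close> by (auto simp: eventually_at_filter divide_strict_right_mono)
  qed
  ultimately have "\<forall>\<^sub>F s in at_right t. X (s / \<nu>) \<omega> = X (t / \<nu>) \<omega>"
    by (rule eventually_compose_filterlim)
  then show "\<forall>\<^sub>F s in at_right t. (of_bool (X (s / \<nu>) \<omega> = j) :: real) = of_bool (X (t / \<nu>) \<omega> = j)"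
    by eventually_elim simp
qed

text \<open>
  The centred occupation time is the limit of Riemann sums \<open>R n\<close> with mesh \<open>\<delta> = t / Suc n\<close>. Their
  summands have geometrically decaying covariances with ratio \<open>exp (- x)\<close>, where
  \<open>x = N * \<gamma> * \<delta> / \<nu>\<close>, which gives the second moment bound
  \<open>t * \<delta> + 2 * t * \<nu> / (N * \<gamma>)\<close>; the first term disappears as the mesh shrinks.
\<close>

lemma occupation_time_ergodic:
  fixes X :: "real \<Rightarrow> 'a \<Rightarrow> 'n::finite" and j :: 'n
  assumes X: "index_process M \<gamma> X" and "0 < \<gamma>" "0 < \<nu>" "0 < t"
  defines "A \<equiv> (\<lambda>\<omega>. integral {0..t} (\<lambda>s. of_bool (X (s / \<nu>) \<omega> = j)))"
  shows "A \<in> borel_measurable M"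
    and "expectation (\<lambda>\<omega>. (A \<omega> - t / real CARD('n))\<^sup>2) \<le> 2 * t / (real CARD('n) * \<gamma>) * \<nu>"
    and "integrable M (\<lambda>\<omega>. (A \<omega> - t / real CARD('n))\<^sup>2)"
proof -
  note [measurable] = index_process_measurable[OF X]
  let ?N = "real CARD('n)"
  define \<psi> where "\<psi> s \<omega> = of_bool (X (s / \<nu>) \<omega> = j) - 1 / ?N" for s \<omega>
  define R where "R n \<omega> = (\<Sum>k<Suc n. t / Suc n * \<psi> (t / Suc n * (real k + 1)) \<omega>)" for n \<omega>
  have \<psi>1: "\<bar>\<psi> s \<omega>\<bar> \<le> 1" for s \<omega>
    by (cases "X (s / \<nu>) \<omega> = j") (auto simp: \<psi>_def)
  have \<psi>_meas: "\<psi> s \<in> borel_measurable M" if "0 \<le> s" for s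
  proof -
    have [simp]: "0 \<le> s / \<nu>" using that \<open>0 < \<nu>\<close> by simp
    show ?thesis unfolding \<psi>_def by measurable
  qed
  have R_meas [measurable]: "R n \<in> borel_measurable M" for n
    unfolding R_def using \<open>0 < t\<close> by (intro borel_measurable_sum borel_measurable_times \<psi>_meas) auto
  have R_le: "\<bar>R n \<omega>\<bar> \<le> t" for n \<omega>
  proof -
    have "\<bar>R n \<omega>\<bar> \<le> (\<Sum>k<Suc n. t / Suc n * 1)"
      unfolding R_def
    proof (rule order_trans[OF sum_abs sum_mono])
      fix k
      show "\<bar>t / Suc n * \<psi> (t / Suc n * (real k + 1)) \<omega>\<bar> \<le> t / Suc n * 1"
        using \<open>0 < t\<close> \<psi>1 unfolding abs_mult by (intro mult_mono) auto
    qed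
    then show ?thesis by simp
  qed
  have R_lim: "(\<lambda>n. R n \<omega>) \<longlonglongrightarrow> A \<omega> - t / ?N" if \<omega>: "\<omega> \<in> space M" for \<omega>
  proof -
    note rc = index_process_right_continuous[OF X \<omega> \<open>0 < \<nu>\<close>]
    have "((\<lambda>s. \<psi> s \<omega>) \<longlongrightarrow> \<psi> s \<omega>) (at_right s)" if "0 \<le> s" for s
      unfolding \<psi>_def by (intro tendsto_diff tendsto_const rc that)
    then have "(\<lambda>n. R n \<omega>) \<longlonglongrightarrow> integral {0..t} (\<lambda>s. \<psi> s \<omega>)"
      unfolding R_def using \<psi>1 \<open>0 < t\<close> by (rule right_continuous_Riemann_sums(2))
    moreover have "(\<lambda>s. of_bool (X (s / \<nu>) \<omega> = j) :: real) integrable_on {0..t}"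
      using \<open>0 < t\<close> rc by (intro right_continuous_Riemann_sums(1)[where B = 1]) auto
    then have "integral {0..t} (\<lambda>s. \<psi> s \<omega>) = A \<omega> - t / ?N"
      unfolding \<psi>_def A_def using \<open>0 < t\<close> by (subst integral_diff) auto
    ultimately show ?thesis by simp
  qed
  have meas: "(\<lambda>\<omega>. A \<omega> - t / ?N) \<in> borel_measurable M"
    using R_lim by (rule borel_measurable_LIMSEQ_real) auto
  from borel_measurable_add[OF this borel_measurable_const[of "t / ?N"]]
  show "A \<in> borel_measurable M" by simp
  have sq: "(\<lambda>n. (R n \<omega>)\<^sup>2) \<longlonglongrightarrow> (A \<omega> - t / ?N)\<^sup>2" if "\<omega> \<in> space M" for \<omega>
    by (intro tendsto_intros R_lim that)
  have sq_le: "norm ((R n \<omega>)\<^sup>2) \<le> t\<^sup>2" for n \<omega>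
    using R_le[of n \<omega>] \<open>0 < t\<close> by (simp flip: abs_le_square_iff)
  have DCT: "(\<lambda>n. expectation (\<lambda>\<omega>. (R n \<omega>)\<^sup>2)) \<longlonglongrightarrow> expectation (\<lambda>\<omega>. (A \<omega> - t / ?N)\<^sup>2)"
      "integrable M (\<lambda>\<omega>. (A \<omega> - t / ?N)\<^sup>2)"
    using meas sq sq_le
    by (auto intro!: integral_dominated_convergence[where w = "\<lambda>_. t\<^sup>2"]
        integrable_dominated_convergence[where w = "\<lambda>_. t\<^sup>2" and s = "\<lambda>n \<omega>. (R n \<omega>)\<^sup>2"])
  show "integrable M (\<lambda>\<omega>. (A \<omega> - t / ?N)\<^sup>2)" by fact
  have "expectation (\<lambda>\<omega>. (R n \<omega>)\<^sup>2) \<le> t\<^sup>2 / Suc n + 2 * t / (?N * \<gamma>) * \<nu>" for n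
  proof -
    define \<delta> where "\<delta> = t / Suc n"
    have "\<delta> > 0" using \<open>0 < t\<close> by (simp add: \<delta>_def)
    have \<delta>n: "\<delta> * Suc n = t" by (simp add: \<delta>_def)
    define x where "x = ?N * \<gamma> * (\<delta> / \<nu>)"
    have "x > 0" using \<open>0 < \<gamma>\<close> \<open>0 < \<nu>\<close> \<open>\<delta> > 0\<close> by (simp add: x_def)
    have "expectation (\<lambda>\<omega>. (\<Sum>k<Suc n. \<psi> (\<delta> * (real k + 1)) \<omega>)\<^sup>2)
        \<le> real (Suc n) * (1 + 2 * (exp (- x) / (1 - exp (- x))))"
    proof (rule expectation_square_sum_geometric)
      fix k l :: nat assume "k < l"
      have "expectation (\<lambda>\<omega>. \<psi> (\<delta> * (real k + 1)) \<omega> * \<psi> (\<delta> * (real l + 1)) \<omega>)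
          \<le> exp (- (?N * \<gamma> * (\<delta> * (real l + 1) / \<nu> - \<delta> * (real k + 1) / \<nu>)))"
        unfolding \<psi>_def using \<open>k < l\<close> \<open>\<delta> > 0\<close> \<open>0 < \<nu>\<close>
        by (intro index_process_covariance_le[OF X] divide_right_mono mult_left_mono) auto
      also have "- (?N * \<gamma> * (\<delta> * (real l + 1) / \<nu> - \<delta> * (real k + 1) / \<nu>)) = real (l - k) * (- x)"
        using \<open>k < l\<close> \<open>0 < \<nu>\<close> by (simp add: x_def of_nat_diff field_simps)
      also have "exp \<dots> = exp (- x) ^ (l - k)"
        by (rule exp_of_nat_mult)
      finally show "expectation (\<lambda>\<omega>. \<psi> (\<delta> * (real k + 1)) \<omega> * \<psi> (\<delta> * (real l + 1)) \<omega>) \<le> exp (- x) ^ (l - k)" .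
    qed (use \<psi>1 \<psi>_meas \<open>x > 0\<close> \<open>\<delta> > 0\<close> in auto)
    also have "\<dots> \<le> real (Suc n) * (1 + 2 * (1 / x))"
      using exp_ratio_le[OF \<open>x > 0\<close>] by (intro mult_left_mono add_mono) auto
    finally have "\<delta>\<^sup>2 * expectation (\<lambda>\<omega>. (\<Sum>k<Suc n. \<psi> (\<delta> * (real k + 1)) \<omega>)\<^sup>2)
        \<le> \<delta>\<^sup>2 * (real (Suc n) * (1 + 2 * (1 / x)))"
      by (intro mult_left_mono) auto
    also have "\<dots> = \<delta> * (\<delta> * Suc n) * (1 + 2 * (1 / x))"
      by (simp add: power2_eq_square)
    also have "\<dots> = t\<^sup>2 / Suc n + 2 * t / (?N * \<gamma>) * \<nu>"
    proof -
      have "\<delta> * (1 / x) = \<nu> / (?N * \<gamma>)"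
        using \<open>\<delta> > 0\<close> \<open>0 < \<nu>\<close> \<open>0 < \<gamma>\<close> by (simp add: x_def)
      then have "\<delta> * t * (1 + 2 * (1 / x)) = \<delta> * t + 2 * t * (\<nu> / (?N * \<gamma>))"
        by (metis (no_types, opaque_lifting) distrib_left mult.assoc mult.commute mult.right_neutral)
      then show ?thesis unfolding \<delta>n by (simp add: \<delta>_def power2_eq_square)
    qed
    finally have "\<delta>\<^sup>2 * expectation (\<lambda>\<omega>. (\<Sum>k<Suc n. \<psi> (\<delta> * (real k + 1)) \<omega>)\<^sup>2) \<le> \<dots>" .
    moreover have "R n \<omega> = \<delta> * (\<Sum>k<Suc n. \<psi> (\<delta> * (real k + 1)) \<omega>)" for \<omega>
      unfolding R_def \<delta>_def sum_distrib_left ..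
    ultimately show ?thesis by (simp only: power_mult_distrib integral_mult_right_zero)
  qed
  moreover have "(\<lambda>n. t\<^sup>2 / Suc n + 2 * t / (?N * \<gamma>) * \<nu>) \<longlonglongrightarrow> 0 + 2 * t / (?N * \<gamma>) * \<nu>"
    by (intro tendsto_add tendsto_const LIMSEQ_Suc[OF lim_const_over_n])
  ultimately show "expectation (\<lambda>\<omega>. (A \<omega> - t / ?N)\<^sup>2) \<le> 2 * t / (?N * \<gamma>) * \<nu>"
    using LIMSEQ_le[OF DCT(1)] by force
qed

end

definition index_weights :: "(real \<Rightarrow> 'w \<Rightarrow> 'n) \<Rightarrow> real \<Rightarrow> 'w \<Rightarrow> real \<Rightarrow> 'n \<Rightarrow> real" where
  "index_weights X \<nu> \<omega> s j = of_bool (X (s / \<nu>) \<omega> = j)"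

lemma mixed_force_index_weights: "mixed_force g (index_weights X \<nu> \<omega>) = (\<lambda>t. g (X (t / \<nu>) \<omega>))"
proof (intro ext)
  fix t x
  have "mixed_force g (index_weights X \<nu> \<omega>) t x = (\<Sum>j\<in>UNIV. if j = X (t / \<nu>) \<omega> then g j x else 0)"
    unfolding mixed_force_def index_weights_def by (intro sum.cong) auto
  then show "mixed_force g (index_weights X \<nu> \<omega>) t x = g (X (t / \<nu>) \<omega>) x" by simp
qed

context prob_space
begin

lemma mixing_weights_index:
  fixes X :: "real \<Rightarrow> 'a \<Rightarrow> 'n::finite"
  assumes "index_process M \<gamma> X" "\<omega> \<in> space M" "0 < \<nu>"
  shows "mixing_weights (index_weights X \<nu> \<omega>)"
  unfolding mixing_weights_def index_weights_def
proof (intro conjI allI impI)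
  fix t :: real and j assume "0 \<le> t"
  show "(\<lambda>s. of_bool (X (s / \<nu>) \<omega> = j) :: real) integrable_on {0..t}"
  proof (cases "t = 0")
    case True
    then show ?thesis
      using integrable_on_refl[of "\<lambda>s. of_bool (X (s / \<nu>) \<omega> = j) :: real" "0::real"] by simp
  next
    case False
    with \<open>0 \<le> t\<close> show ?thesis
      by (intro right_continuous_Riemann_sums(1)[where B = 1]
          index_process_right_continuous[OF assms]) auto
  qed
qed (simp_all add: of_bool_def)

text \<open>
  Negative \<open>t\<close> give an empty interval of integration and the value zero; they are included so
  that all rational numbers can index the observables of a path.
\<close>

lemma measurable_occupation:
  fixes X :: "real \<Rightarrow> 'a \<Rightarrow> 'n::finite"
  assumes "index_process M \<gamma> X" "0 < \<gamma>" "0 < \<nu>"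
  shows "(\<lambda>\<omega>. occupation (index_weights X \<nu> \<omega>) j t) \<in> borel_measurable M"
proof (cases "0 < t")
  case True
  then show ?thesis
    using occupation_time_ergodic(1)[OF assms] by (simp add: occupation_def index_weights_def)
next
  case False
  then have "occupation (index_weights X \<nu> \<omega>) j t = 0" for \<omega>
    by (cases "t = 0") (auto simp: occupation_def)
  then show ?thesis by simp
qed

text \<open>
  Chebyshev's inequality. The bound is linear in \<open>\<nu>\<close>, so a union over finitely many \<open>t\<close> and \<open>j\<close>
  keeps this form.
\<close>

lemma prob_occupation_deviation_le:
  fixes X :: "real \<Rightarrow> 'a \<Rightarrow> 'n::finite"
  assumes X: "index_process M \<gamma> X" and "0 < \<gamma>" "0 < \<nu>" "0 \<le> t" "0 < \<eta>"
  shows "prob {\<omega>\<in>space M. \<eta> \<le> \<bar>occupation (index_weights X \<nu> \<omega>) j t - t / real CARD('n)\<bar>}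
    \<le> 2 * t / (real CARD('n) * \<gamma> * \<eta>\<^sup>2) * \<nu>"
proof (cases "t = 0")
  case True
  then have empty: "{\<omega>\<in>space M. \<eta> \<le> \<bar>occupation (index_weights X \<nu> \<omega>) j t - t / real CARD('n)\<bar>} = {}"
    using \<open>0 < \<eta>\<close> by (auto simp: occupation_def)
  show ?thesis unfolding empty using True by simp
next
  case False
  let ?A = "\<lambda>\<omega>. occupation (index_weights X \<nu> \<omega>) j t"
  have "0 < t" using False \<open>0 \<le> t\<close> by simp
  have bound: "expectation (\<lambda>\<omega>. (?A \<omega> - t / real CARD('n))\<^sup>2) \<le> 2 * t / (real CARD('n) * \<gamma>) * \<nu>"
    and int: "integrable M (\<lambda>\<omega>. (?A \<omega> - t / real CARD('n))\<^sup>2)"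
    using occupation_time_ergodic(2,3)[OF assms(1-3) \<open>0 < t\<close>]
    by (simp_all add: occupation_def index_weights_def)
  have "{\<omega>\<in>space M. \<eta> \<le> \<bar>?A \<omega> - t / real CARD('n)\<bar>} = {\<omega>\<in>space M. \<eta>\<^sup>2 \<le> (?A \<omega> - t / real CARD('n))\<^sup>2}"
    using \<open>0 < \<eta>\<close> by (simp flip: abs_le_square_iff)
  also have "prob \<dots> \<le> expectation (\<lambda>\<omega>. (?A \<omega> - t / real CARD('n))\<^sup>2) / \<eta>\<^sup>2"
    using \<open>0 < \<eta>\<close> by (intro integral_Markov_inequality_measure[OF int, where A = "{}"]) auto
  also have "\<dots> \<le> 2 * t / (real CARD('n) * \<gamma>) * \<nu> / \<eta>\<^sup>2"
    using bound by (intro divide_right_mono) auto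
  finally show ?thesis by (simp add: field_simps)
qed

end

section \<open>Measurability of the solution path\<close>

text \<open>
  The hypothesis says that \<open>Z\<close> factors through a continuous map on the range of \<open>A\<close>, with the
  product topology. The range may fail to be a Borel set, but preimages of open sets are traces on it
  of open sets \<open>U\<close> of the full product, and the product of countably many real lines is second
  countable, so \<open>A\<close> itself is Borel measurable.
\<close>

lemma borel_measurable_of_finitely_many_observables:
  fixes A :: "'w \<Rightarrow> 'i::countable \<Rightarrow> real" and Z :: "'w \<Rightarrow> 'b::topological_space"
  assumes A: "\<And>k. (\<lambda>\<omega>. A \<omega> k) \<in> borel_measurable M"
    and loc: "\<And>\<omega> V. \<lbrakk>\<omega> \<in> space M; open V; Z \<omega> \<in> V\<rbrakk> \<Longrightarrow>
      \<exists>S \<eta>. finite S \<and> 0 < \<eta> \<and> (\<forall>\<omega>'\<in>space M. (\<forall>k\<in>S. \<bar>A \<omega>' k - A \<omega> k\<bar> < \<eta>) \<longrightarrow> Z \<omega>' \<in> V)"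
  shows "Z \<in> borel_measurable M"
proof (rule borel_measurableI)
  fix V :: "'b set" assume V: "open V"
  \<comment> \<open>The largest open set of observable values that forces \<open>Z\<close> into \<open>V\<close>.\<close>
  define U where "U = \<Union>{W. open W \<and> (\<forall>\<omega>\<in>space M. A \<omega> \<in> W \<longrightarrow> Z \<omega> \<in> V)}"
  have "open U" unfolding U_def by (intro open_Union) auto
  have "A \<omega> \<in> U" if \<omega>: "\<omega> \<in> space M" "Z \<omega> \<in> V" for \<omega>
  proof -
    obtain S \<eta> where S: "finite S" "0 < (\<eta>::real)"
      "\<And>\<omega>'. \<omega>' \<in> space M \<Longrightarrow> (\<forall>k\<in>S. \<bar>A \<omega>' k - A \<omega> k\<bar> < \<eta>) \<Longrightarrow> Z \<omega>' \<in> V"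
      using loc[OF \<omega>(1) V \<omega>(2)] by metis
    have "open ((\<lambda>x :: 'i \<Rightarrow> real. x k) -` ball (A \<omega> k) \<eta>)" for k
      by (intro open_vimage) auto
    then have "open (\<Inter>k\<in>S. (\<lambda>x :: 'i \<Rightarrow> real. x k) -` ball (A \<omega> k) \<eta>)"
      using S(1) by (intro open_INT) auto
    moreover have "A \<omega> \<in> (\<Inter>k\<in>S. (\<lambda>x. x k) -` ball (A \<omega> k) \<eta>)" using S(2) by auto
    moreover have "Z \<omega>' \<in> V" if "\<omega>' \<in> space M" "A \<omega>' \<in> (\<Inter>k\<in>S. (\<lambda>x. x k) -` ball (A \<omega> k) \<eta>)" for \<omega>'
      using that by (intro S(3)) (auto simp: dist_real_def abs_minus_commute)
    ultimately show ?thesis unfolding U_def by blast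
  qed
  then have "Z -` V \<inter> space M = A -` U \<inter> space M" by (auto simp: U_def)
  also have "A \<in> borel_measurable M" using A by (rule measurable_coordinatewise_then_product)
  then have "A -` U \<inter> space M \<in> sets M" using \<open>open U\<close> by (intro measurable_sets) auto
  finally show "Z -` V \<inter> space M \<in> sets M" .
qed

context prob_space
begin

text \<open>
  The observables are the occupation times at all rational times. The paths of any two outcomes are
  compared directly: whenever their observables agree up to \<open>\<eta>\<close> on a suitable finite set, the two
  solutions are close.
\<close>

lemma measurable_solution_path:
  fixes X :: "real \<Rightarrow> 'a \<Rightarrow> 'n::finite" and g :: "'n \<Rightarrow> 'b::euclidean_space \<Rightarrow> 'b"
  assumes X: "index_process M \<gamma> X" and "0 < \<gamma>" "0 < \<nu>"
    and lip: "\<And>j. L-lipschitz_on UNIV (g j)" and "0 \<le> \<alpha>"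
    and sol: "\<And>\<omega>. \<omega> \<in> space M \<Longrightarrow> momentum_solution (\<lambda>t. g (X (t / \<nu>) \<omega>)) \<alpha> q0 p0 (q \<omega>) (p \<omega>)"
  shows "(\<lambda>\<omega>. to_cpath (\<lambda>t. (p \<omega> t, q \<omega> t))) \<in> borel_measurable M"
proof (rule borel_measurable_of_finitely_many_observables)
  let ?w = "index_weights X \<nu>" and ?Z = "\<lambda>\<omega>. to_cpath (\<lambda>t. (p \<omega> t, q \<omega> t))"
  let ?A = "\<lambda>\<omega> (r, j). occupation (?w \<omega>) j (of_rat r)"
  show "(\<lambda>\<omega>. ?A \<omega> k) \<in> borel_measurable M" for k
    by (cases k) (simp add: measurable_occupation[OF assms(1-3)])
  have sol': "momentum_solution (mixed_force g (?w \<omega>)) \<alpha> q0 p0 (q \<omega>) (p \<omega>)" if "\<omega> \<in> space M" for \<omega>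
    unfolding mixed_force_index_weights using that by (rule sol)
  note w = mixing_weights_index[OF X _ \<open>0 < \<nu>\<close>]
  fix \<omega> V assume \<omega>: "\<omega> \<in> space M" and "open V" "?Z \<omega> \<in> V"
  then obtain \<epsilon> where \<epsilon>: "0 < \<epsilon>" "\<And>z. dist z (?Z \<omega>) < \<epsilon> \<Longrightarrow> z \<in> V"
    unfolding open_dist by blast
  obtain S \<eta> where S: "finite S" "S \<subseteq> {0..}" "0 < (\<eta>::real)"
    and close: "\<forall>w' q' p'. mixing_weights w' \<longrightarrow> momentum_solution (mixed_force g w') \<alpha> q0 p0 q' p' \<longrightarrow>
      (\<forall>r\<in>S. \<forall>j. \<bar>occupation w' j (of_rat r) - occupation (?w \<omega>) j (of_rat r)\<bar> < \<eta>) \<longrightarrow>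
      dist (to_cpath (\<lambda>t. (p' t, q' t))) (?Z \<omega>) < \<epsilon>"
    by (rule solution_continuous_in_occupation[OF lip \<open>0 \<le> \<alpha>\<close> w[OF \<omega>] sol'[OF \<omega>] \<epsilon>(1)])
  show "\<exists>S \<eta>. finite S \<and> 0 < \<eta> \<and> (\<forall>\<omega>'\<in>space M. (\<forall>k\<in>S. \<bar>?A \<omega>' k - ?A \<omega> k\<bar> < \<eta>) \<longrightarrow> ?Z \<omega>' \<in> V)"
  proof (intro exI conjI ballI impI)
    show "finite (S \<times> (UNIV :: 'n set))" using S by simp
    show "0 < \<eta>" by fact
    fix \<omega>' assume \<omega>': "\<omega>' \<in> space M"
      and near: "\<forall>k\<in>S \<times> UNIV. \<bar>?A \<omega>' k - ?A \<omega> k\<bar> < \<eta>"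
    show "?Z \<omega>' \<in> V"
    proof (intro \<epsilon>(2) close[rule_format, OF w[OF \<omega>'] sol'[OF \<omega>']])
      fix r and j :: 'n assume "r \<in> S"
      then show "\<bar>occupation (?w \<omega>') j (of_rat r) - occupation (?w \<omega>) j (of_rat r)\<bar> < \<eta>"
        using near[rule_format, of "(r, j)"] by simp
    qed
  qed
qed

end

section \<open>Gradient of the averaged potential\<close>

lemma grad_eqI:
  fixes f :: "'a::euclidean_space \<Rightarrow> real"
  assumes "GDERIV f x :> D"
  shows "grad f x = D"
  unfolding grad_def
proof (rule the_equality)
  fix D' assume "GDERIV f x :> D'"
  then have "(\<lambda>h. h \<bullet> D') = (\<lambda>h. h \<bullet> D)"
    using assms unfolding gderiv_def by (rule has_derivative_unique)
  then have "\<forall>h. h \<bullet> D' = h \<bullet> D" by metis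
  then show "D' = D" by (metis vector_eq_rdot vector_eq_ldot)
qed (rule assms)

text \<open>
  In a Euclidean space the derivative is represented by the inner product with the vector of its
  values on the basis; together with uniqueness of the derivative this gives the description in \<open>grad\<close>
  its meaning.
\<close>

lemma C1_function_GDERIV_grad:
  fixes f :: "'a::euclidean_space \<Rightarrow> real"
  assumes "C1_function f"
  shows "GDERIV f x :> grad f x"
proof -
  obtain f' where f': "(f has_derivative f') (at x)"
    using assms unfolding C1_function_def differentiable_def by blast
  then interpret f': bounded_linear f' by (rule has_derivative_bounded_linear)
  define D where "D = (\<Sum>b\<in>Basis. f' b *\<^sub>R b)"
  have "f' h = h \<bullet> D" for h
  proof -
    have "f' h = f' (\<Sum>b\<in>Basis. (h \<bullet> b) *\<^sub>R b)" by (simp add: euclidean_representation)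
    also have "\<dots> = h \<bullet> D" by (simp add: f'.sum f'.scaleR D_def inner_sum_right mult.commute)
    finally show ?thesis .
  qed
  then have "f' = (\<lambda>h. h \<bullet> D)" by auto
  with f' have "GDERIV f x :> D" by (simp add: gderiv_def)
  then show ?thesis using grad_eqI by metis
qed

lemma grad_mean:
  fixes \<Phi> :: "'n::finite \<Rightarrow> 'a::euclidean_space \<Rightarrow> real"
  assumes "\<And>j. C1_function (\<Phi> j)"
  shows "grad (\<lambda>x. c * (\<Sum>j\<in>UNIV. \<Phi> j x)) x = (\<Sum>j\<in>UNIV. c *\<^sub>R grad (\<Phi> j) x)"
proof (rule grad_eqI)
  have "(\<Phi> j has_derivative (\<lambda>h. h \<bullet> grad (\<Phi> j) x)) (at x)" for j
    using C1_function_GDERIV_grad[OF assms] unfolding gderiv_def .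
  then have "((\<lambda>x. c * (\<Sum>j\<in>UNIV. \<Phi> j x)) has_derivative
      (\<lambda>h. c * (\<Sum>j\<in>UNIV. h \<bullet> grad (\<Phi> j) x))) (at x)"
    by (intro has_derivative_mult_right has_derivative_sum)
  then show "GDERIV (\<lambda>x. c * (\<Sum>j\<in>UNIV. \<Phi> j x)) x :> (\<Sum>j\<in>UNIV. c *\<^sub>R grad (\<Phi> j) x)"
    by (simp add: gderiv_def inner_sum_right sum_distrib_left)
qed

section \<open>Convergence in law\<close>

context prob_space
begin

lemma expectation_close_of_probable:
  fixes f :: "'a \<Rightarrow> real"
  assumes f: "f \<in> borel_measurable M" and b: "\<And>\<omega>. \<bar>f \<omega>\<bar> \<le> b" "\<bar>c\<bar> \<le> b"
    and B: "B \<in> events" "prob B \<le> \<beta>" and close: "\<And>\<omega>. \<omega> \<in> space M - B \<Longrightarrow> \<bar>f \<omega> - c\<bar> \<le> e" and "0 \<le> e"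
  shows "\<bar>expectation f - c\<bar> \<le> e + 2 * b * \<beta>"
proof -
  have int: "integrable M f"
    using b f by (intro integrable_const_bound[where B = b]) auto
  have "0 \<le> b" using b(2) by linarith
  have "\<bar>expectation f - c\<bar> = \<bar>expectation (\<lambda>\<omega>. f \<omega> - c)\<bar>"
    using int by (simp add: prob_space)
  also have "\<dots> \<le> expectation (\<lambda>\<omega>. \<bar>f \<omega> - c\<bar>)" by (rule integral_abs_bound)
  also have "\<dots> \<le> expectation (\<lambda>\<omega>. e + 2 * b * indicator B \<omega>)"
  proof (rule integral_mono)
    fix \<omega> assume \<omega>: "\<omega> \<in> space M"
    show "\<bar>f \<omega> - c\<bar> \<le> e + 2 * b * indicator B \<omega>"
    proof (cases "\<omega> \<in> B")
      case True
      then show ?thesis using b(1)[of \<omega>] b(2) \<open>0 \<le> e\<close> by simp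
    qed (use close \<omega> in auto)
  qed (use int B in \<open>auto simp: emeasure_eq_measure\<close>)
  also have "\<dots> = e + 2 * b * prob B"
    using B by (simp add: prob_space emeasure_eq_measure)
  also have "\<dots> \<le> e + 2 * b * \<beta>"
    using B \<open>0 \<le> b\<close> by (intro add_left_mono mult_left_mono) auto
  finally show ?thesis .
qed

text \<open>
  The exceptional event says that some occupation time from the finite list belonging to the averaged
  solution deviates from its mean by at least \<open>\<eta>\<close>. It is defined by finitely many random variables,
  contains all outcomes whose path is far from the limit, and has probability at most \<open>C * \<nu>\<close>.
\<close>

lemma expectation_of_solution_path_tendsto:
  fixes X :: "real \<Rightarrow> 'a \<Rightarrow> 'n::finite" and g :: "'n \<Rightarrow> 'b::euclidean_space \<Rightarrow> 'b"
    and F :: "('b \<times> 'b) cpath \<Rightarrow> real"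
  assumes X: "index_process M \<gamma> X" and "0 < \<gamma>"
    and lip: "\<And>j. L-lipschitz_on UNIV (g j)" and "0 \<le> \<alpha>"
    and sol\<nu>: "\<And>\<nu> \<omega>. 0 < \<nu> \<Longrightarrow> \<omega> \<in> space M \<Longrightarrow>
      momentum_solution (\<lambda>t. g (X (t / \<nu>) \<omega>)) \<alpha> q0 p0 (q\<nu> \<nu> \<omega>) (p\<nu> \<nu> \<omega>)"
    and sol: "momentum_solution (\<lambda>t x. \<Sum>j\<in>UNIV. (1 / real CARD('n)) *\<^sub>R g j x) \<alpha> q0 p0 q p"
    and F: "continuous_on UNIV F" "bounded (range F)"
  shows "((\<lambda>\<nu>. expectation (\<lambda>\<omega>. F (to_cpath (\<lambda>t. (p\<nu> \<nu> \<omega> t, q\<nu> \<nu> \<omega> t)))))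
    \<longlongrightarrow> F (to_cpath (\<lambda>t. (p t, q t)))) (at_right 0)"
proof (rule tendstoI)
  fix e :: real assume "0 < e"
  let ?N = "real CARD('n)" and ?u = "\<lambda>_ _. 1 / real CARD('n)"
  let ?z = "to_cpath (\<lambda>t. (p t, q t))" and ?Z = "\<lambda>\<nu> \<omega>. to_cpath (\<lambda>t. (p\<nu> \<nu> \<omega> t, q\<nu> \<nu> \<omega> t))"
  obtain b where b: "\<And>z. \<bar>F z\<bar> \<le> b" using F(2) by (auto simp: bounded_iff)
  have "isCont F ?z" using F(1) by (simp add: continuous_on_eq_continuous_at)
  then obtain \<epsilon> where \<epsilon>: "0 < \<epsilon>" "\<And>z. dist z ?z < \<epsilon> \<Longrightarrow> \<bar>F z - F ?z\<bar> < e / 2"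
    unfolding continuous_at_eps_delta using \<open>0 < e\<close> by (metis dist_real_def half_gt_zero)
  have u: "mixing_weights (?u :: real \<Rightarrow> 'n \<Rightarrow> real)"
    by (auto simp: mixing_weights_def)
  have sol': "momentum_solution (mixed_force g ?u) \<alpha> q0 p0 q p"
    using sol by (simp add: mixed_force_def[abs_def])
  obtain S \<eta> where S: "finite S" "S \<subseteq> {0..}" "0 < (\<eta>::real)"
    and close: "\<forall>w' q' p'. mixing_weights w' \<longrightarrow> momentum_solution (mixed_force g w') \<alpha> q0 p0 q' p' \<longrightarrow>
      (\<forall>r\<in>S. \<forall>j. \<bar>occupation w' j (of_rat r) - occupation ?u j (of_rat r)\<bar> < \<eta>) \<longrightarrow>
      dist (to_cpath (\<lambda>t. (p' t, q' t))) ?z < \<epsilon>"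
    by (rule solution_continuous_in_occupation[OF lip \<open>0 \<le> \<alpha>\<close> u sol' \<epsilon>(1)])
  have occ_u: "occupation ?u j (of_rat r) = of_rat r / ?N" if "r \<in> S" for r and j :: 'n
    using S(2) that by (auto simp: occupation_def)
  define C where "C = (\<Sum>(r, j)\<in>S \<times> (UNIV :: 'n set). 2 * of_rat r / (?N * \<gamma> * \<eta>\<^sup>2))"
  have bound: "\<bar>expectation (\<lambda>\<omega>. F (?Z \<nu> \<omega>)) - F ?z\<bar> \<le> e / 2 + 2 * b * (C * \<nu>)" if "0 < \<nu>" for \<nu>
  proof (rule expectation_close_of_probable)
    let ?A = "\<lambda>\<omega>. occupation (index_weights X \<nu> \<omega>)"
    let ?D = "\<lambda>(r, j). {\<omega>\<in>space M. \<eta> \<le> \<bar>?A \<omega> j (of_rat r) - of_rat r / ?N\<bar>}"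
    note [measurable] = measurable_occupation[OF X \<open>0 < \<gamma>\<close> \<open>0 < \<nu>\<close>]
    have D: "?D k \<in> events" for k by (cases k) simp
    show "(\<lambda>\<omega>. F (?Z \<nu> \<omega>)) \<in> borel_measurable M"
    proof -
      have "?Z \<nu> \<in> borel_measurable M"
        by (rule measurable_solution_path[OF X \<open>0 < \<gamma>\<close> that lip \<open>0 \<le> \<alpha>\<close> sol\<nu>[OF that]])
      from measurable_compose[OF this borel_measurable_continuous_onI[OF F(1)]] show ?thesis .
    qed
    show "(\<Union>k\<in>S \<times> UNIV. ?D k) \<in> events" using S(1) D by (intro sets.finite_UN) auto
    have "prob (\<Union>k\<in>S \<times> UNIV. ?D k) \<le> (\<Sum>k\<in>S \<times> UNIV. prob (?D k))"
      using S(1) D by (intro finite_measure_subadditive_finite) auto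
    also have "\<dots> \<le> (\<Sum>(r, j)\<in>S \<times> (UNIV :: 'n set). 2 * of_rat r / (?N * \<gamma> * \<eta>\<^sup>2) * \<nu>)"
    proof (intro sum_mono)
      fix k :: "rat \<times> 'n" assume k: "k \<in> S \<times> UNIV"
      obtain r j where rj: "k = (r, j)" by (cases k)
      have "0 \<le> real_of_rat r" using k S(2) by (auto simp: rj)
      from prob_occupation_deviation_le[OF X \<open>0 < \<gamma>\<close> \<open>0 < \<nu>\<close> this \<open>0 < \<eta>\<close>, of j]
      show "prob (?D k) \<le> (case k of (r, j) \<Rightarrow> 2 * of_rat r / (?N * \<gamma> * \<eta>\<^sup>2) * \<nu>)" by (simp add: rj)
    qed
    also have "\<dots> = C * \<nu>" by (simp add: C_def sum_distrib_right case_prod_unfold)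
    finally show "prob (\<Union>k\<in>S \<times> UNIV. ?D k) \<le> C * \<nu>" .
    fix \<omega> assume \<omega>: "\<omega> \<in> space M - (\<Union>k\<in>S \<times> UNIV. ?D k)"
    have "dist (?Z \<nu> \<omega>) ?z < \<epsilon>"
    proof (rule close[rule_format])
      show "mixing_weights (index_weights X \<nu> \<omega>)"
        using \<omega> by (intro mixing_weights_index[OF X _ that]) auto
      show "momentum_solution (mixed_force g (index_weights X \<nu> \<omega>)) \<alpha> q0 p0 (q\<nu> \<nu> \<omega>) (p\<nu> \<nu> \<omega>)"
        unfolding mixed_force_index_weights using \<omega> that by (intro sol\<nu>) auto
      fix r and j :: 'n assume "r \<in> S"
      then have "(r, j) \<in> S \<times> UNIV" by simp
      then have "\<omega> \<notin> ?D (r, j)" using \<omega> by blast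
      then show "\<bar>?A \<omega> j (of_rat r) - occupation ?u j (of_rat r)\<bar> < \<eta>"
        using \<omega> unfolding occ_u[OF \<open>r \<in> S\<close>] by simp
    qed
    then show "\<bar>F (?Z \<nu> \<omega>) - F ?z\<bar> \<le> e / 2" using \<epsilon>(2) by (simp add: less_imp_le)
  qed (use b \<open>0 < e\<close> in auto)
  have "((\<lambda>\<nu>. 2 * b * (C * \<nu>)) \<longlongrightarrow> 2 * b * (C * 0)) (at_right 0)"
    by (intro tendsto_intros)
  then have "\<forall>\<^sub>F \<nu> in at_right 0. 2 * b * (C * \<nu>) < e / 2"
    using \<open>0 < e\<close> by (intro order_tendstoD(2)) auto
  then show "\<forall>\<^sub>F \<nu> in at_right 0. dist (expectation (\<lambda>\<omega>. F (?Z \<nu> \<omega>))) (F ?z) < e"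
    using eventually_at_right_less
  proof eventually_elim
    case (elim \<nu>)
    then show ?case using bound[of \<nu>] by (simp add: dist_real_def)
  qed
qed

end

theorem theorem5:
  fixes M :: "'w measure"
    and i :: "real \<Rightarrow> 'w \<Rightarrow> 'n::finite"
    and \<Phi> :: "'n \<Rightarrow> real^'k \<Rightarrow> real"
    and \<gamma> L \<alpha> :: real
    and p0 q0 :: "real^'k"
    and q\<nu> p\<nu> :: "real \<Rightarrow> 'w \<Rightarrow> real \<Rightarrow> real^'k"
    and q p :: "real \<Rightarrow> real^'k"
    and F :: "((real^'k) \<times> (real^'k)) cpath \<Rightarrow> real"
  defines "\<Phi>bar \<equiv> (\<lambda>x. (1 / real CARD('n)) * (\<Sum>j\<in>UNIV. \<Phi> j x))"
  assumes "prob_space M"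
    and "0 < \<gamma>" and "index_process M \<gamma> i"
    and "0 < L" and "\<And>j. C1_function (\<Phi> j)" and "\<And>j. L-lipschitz_on UNIV (grad (\<Phi> j))"
    and "0 < \<alpha>"
    and "\<And>\<nu> \<omega>. 0 < \<nu> \<Longrightarrow> \<omega> \<in> space M \<Longrightarrow>
           momentum_solution (\<lambda>t. grad (\<Phi> (i (t / \<nu>) \<omega>))) \<alpha> q0 p0 (q\<nu> \<nu> \<omega>) (p\<nu> \<nu> \<omega>)"
    and "momentum_solution (\<lambda>t. grad \<Phi>bar) \<alpha> q0 p0 q p"
    and "continuous_on UNIV F" and "bounded (range F)"
  shows "((\<lambda>\<nu>. \<integral>\<omega>. F (to_cpath (\<lambda>t. (p\<nu> \<nu> \<omega> t, q\<nu> \<nu> \<omega> t))) \<partial>M)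
            \<longlongrightarrow> (\<integral>\<omega>. F (to_cpath (\<lambda>t. (p t, q t))) \<partial>M)) (at_right 0) \<and>
         (\<integral>\<omega>. F (to_cpath (\<lambda>t. (p t, q t))) \<partial>M) = F (to_cpath (\<lambda>t. (p t, q t)))"
proof -
  interpret prob_space M by fact
  have "grad \<Phi>bar x = (\<Sum>j\<in>UNIV. (1 / real CARD('n)) *\<^sub>R grad (\<Phi> j) x)" for x
    unfolding \<Phi>bar_def by (rule grad_mean) fact
  then have "grad \<Phi>bar = (\<lambda>x. \<Sum>j\<in>UNIV. (1 / real CARD('n)) *\<^sub>R grad (\<Phi> j) x)" by auto
  then have sol: "momentum_solution (\<lambda>t x. \<Sum>j\<in>UNIV. (1 / real CARD('n)) *\<^sub>R grad (\<Phi> j) x) \<alpha> q0 p0 q p"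
    using \<open>momentum_solution (\<lambda>t. grad \<Phi>bar) \<alpha> q0 p0 q p\<close> by simp
  have const: "(\<integral>\<omega>. F (to_cpath (\<lambda>t. (p t, q t))) \<partial>M) = F (to_cpath (\<lambda>t. (p t, q t)))"
    by (simp add: prob_space)
  show ?thesis
    unfolding const
    using expectation_of_solution_path_tendsto[where g = "\<lambda>j. grad (\<Phi> j)", OF \<open>index_process M \<gamma> i\<close> \<open>0 < \<gamma>\<close> assms(7) _ assms(9) sol assms(11,12)]
      \<open>0 < \<alpha>\<close> by simp
qed

end
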